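(* Let $p>3$ be a prime, $x\in\mathbb Z_p$ with $x\not\equiv0,-1\pmod p$, and $x'=(x-\langle x\rangle_p)/p$. Then $$\sum_{n=0}^{p-1}(2n+1)V_n(x)\equiv p^3\frac{x'(x'+1)}{x(x+1)}+2p^4\frac{x'(x'+1)+1}{x(x+1)}H_{\langle x\rangle_p}\pmod{p^5}.$$ Consequently $$\sum_{n=0}^{p-1}(2n+1)\frac{V_n}{16^n}\equiv p^3+12p^4q_p(2)\pmod{p^5},\quad\sum_{n=0}^{p-1}(2n+1)\frac{V_n^{(3)}}{27^n}\equiv p^3+\tfrac{21}2p^4q_p(3)\pmod{p^5},$$ $$\sum_{n=0}^{p-1}(2n+1)\frac{V_n^{(4)}}{64^n}\equiv p^3+26p^4q_p(2)\pmod{p^5},$$ and for $p>5$, $\sum_{n=0}^{p-1}(2n+1)\frac{V_n^{(6)}}{432^n}\equiv p^3+\tfrac{31}5p^4(4q_p(2)+3q_p(3))\pmod{p^5}$.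
   Context: For real $x$ and integer $k\ge0$, $\binom xk=x(x-1)\cdots(x-k+1)/k!$. $V_n(x)=\sum_{k=0}^n\binom nk\binom{n+k}k(-1)^k\binom xk\binom{-1-x}k$. $\mathbb Z_p$: rationals with denominator prime to $p$; congruences modulo powers of $p$ are in $\mathbb Z_p$; for $x\in\mathbb Z_p$, $\langle x\rangle_p\in\{0,\ldots,p-1\}$ with $x\equiv\langle x\rangle_p\pmod p$. $H_m=\sum_{i=1}^m1/i$, $H_0=0$. $q_p(a)=(a^{p-1}-1)/p$ is the Fermat quotient. $V_n=16^nV_n(-\tfrac12)=\sum_{k=0}^n\binom{2k}k^2\binom{2n-2k}{n-k}^2$, $V_n^{(3)}=27^nV_n(-\tfrac13)$, $V_n^{(4)}=64^nV_n(-\tfrac14)$, $V_n^{(6)}=432^nV_n(-\tfrac16)$. *)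

theory Defs
  imports Complex_Main "HOL-Computational_Algebra.Primes"
begin

definition p_integral :: "nat \<Rightarrow> rat set" where
  "p_integral p = {r. coprime (snd (quotient_of r)) (int p)}"

text \<open>Congruence modulo \<open>p ^ m\<close> in the ring of \<open>p\<close>-integral rationals; in particular it
  asserts that both sides are \<open>p\<close>-integral.\<close>

definition pcong :: "nat \<Rightarrow> nat \<Rightarrow> rat \<Rightarrow> rat \<Rightarrow> bool" where
  "pcong p m a b \<longleftrightarrow> a \<in> p_integral p \<and> b \<in> p_integral p \<and>
     (\<exists>c \<in> p_integral p. a - b = of_nat p ^ m * c)"

definition presidue :: "nat \<Rightarrow> rat \<Rightarrow> nat" where
  "presidue p x = (THE r. r < p \<and> pcong p 1 x (of_nat r))"

definition pquot :: "nat \<Rightarrow> rat \<Rightarrow> rat" where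
  "pquot p x = (x - of_nat (presidue p x)) / of_nat p"

text \<open>The library's \<open>harm\<close> is not available over the rationals.\<close>

definition H :: "nat \<Rightarrow> rat" where
  "H m = (\<Sum>i = 1..m. 1 / of_nat i)"

definition fermat_quot :: "nat \<Rightarrow> nat \<Rightarrow> rat" where
  "fermat_quot p a = (of_nat a ^ (p - 1) - 1) / of_nat p"

definition Vpoly :: "nat \<Rightarrow> 'a::field_char_0 \<Rightarrow> 'a" where
  "Vpoly n x = (\<Sum>k = 0..n. of_nat (n choose k) * of_nat ((n + k) choose k) * (-1) ^ k *
     (x gchoose k) * ((-1 - x) gchoose k))"

text \<open>\<open>Vseq n\<close> equals \<open>16 ^ n * Vpoly n (-1/2)\<close>; the integer-sum form is the one taken as
  definition. The other three sequences are given through \<open>Vpoly\<close> directly.\<close>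

definition Vseq :: "nat \<Rightarrow> nat" where
  "Vseq n = (\<Sum>k = 0..n. ((2 * k) choose k)\<^sup>2 * ((2 * n - 2 * k) choose (n - k))\<^sup>2)"

definition V3 :: "nat \<Rightarrow> rat" where "V3 n = 27 ^ n * Vpoly n (- 1 / 3)"

definition V4 :: "nat \<Rightarrow> rat" where "V4 n = 64 ^ n * Vpoly n (- 1 / 4)"

definition V6 :: "nat \<Rightarrow> rat" where "V6 n = 432 ^ n * Vpoly n (- 1 / 6)"

end

theory Submission
  imports Defs "HOL-Computational_Algebra.Formal_Power_Series"
begin

text \<open>
  Put \<open>P\<^sub>k(x) = (x choose k) (-1-x choose k)\<close> and \<open>a = x(x+1)\<close>, so that \<open>(k+1)\<^sup>2 P\<^sub>k\<^sub>+\<^sub>1 = (k(k+1) - a) P\<^sub>k\<close>.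
  Summing over \<open>n\<close> first, the weighted sum equals
  \<open>p\<^sup>2 \<Sum>\<^sub>k\<^sub><\<^sub>p w\<^sub>k P\<^sub>k/(k+1)\<close> with \<open>w\<^sub>k = \<Prod>\<^sub>i\<^sub>\<le>\<^sub>k (1 - p\<^sup>2/i\<^sup>2) \<equiv> 1 - p\<^sup>2 \<Sum>\<^sub>i\<^sub>\<le>\<^sub>k 1/i\<^sup>2\<close>.
  The sum of the \<open>P\<^sub>k/(k+1)\<close> telescopes to \<open>-p P\<^sub>p/a\<close>, and summation by parts turns the second-order
  term into \<open>(\<Sum>\<^sub>0\<^sub><\<^sub>k\<^sub><\<^sub>p P\<^sub>k/k)/a\<close>, which modulo \<open>p\<close> depends only on the residue \<open>r\<close> of \<open>x\<close> and equals
  \<open>-2H\<^sub>r/a\<close>. Writing \<open>x = r + pt\<close>, one has \<open>(x choose p) \<equiv> t(1 + pH\<^sub>r)\<close> modulo \<open>p\<^sup>2\<close>, which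
  evaluates \<open>P\<^sub>p\<close>. For \<open>x = -1/m\<close> the residue is \<open>\<lfloor>p/m\<rfloor>\<close> or \<open>p-1-\<lfloor>p/m\<rfloor>\<close>, and Lerch's congruence
  \<open>m q\<^sub>p(m) \<equiv> -\<Sum>\<^sub>0\<^sub><\<^sub>j\<^sub><\<^sub>m H\<^bsub>\<lfloor>jp/m\<rfloor>\<^esub>\<close> expresses \<open>H\<^sub>r\<close> by Fermat quotients.
\<close>

section \<open>\<open>p\<close>-integral rationals\<close>

locale prime_modulus =
  fixes p :: nat
  assumes p: "prime p"
begin

lemma coprime_prime_nonzero: "coprime b (int p) \<Longrightarrow> b \<noteq> 0"
  using prime_gt_1_nat[OF p] by (cases "b = 0") auto

text \<open>Frees later arguments from the reduced form: the reduced denominator \<open>d\<close> is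
  coprime to \<open>c\<close> and divides \<open>c * b\<close>, so it divides \<open>b\<close> and
  inherits coprimality to \<open>p\<close>.\<close>

lemma p_integral_iff:
  "r \<in> p_integral p \<longleftrightarrow> (\<exists>a b. coprime b (int p) \<and> r = of_int a / of_int b)"
proof
  assume "r \<in> p_integral p"
  then show "\<exists>a b. coprime b (int p) \<and> r = of_int a / of_int b"
    unfolding p_integral_def
    by (metis mem_Collect_eq prod.collapse quotient_of_div)
next
  assume "\<exists>a b. coprime b (int p) \<and> r = of_int a / of_int b"
  then obtain a b where ab: "coprime b (int p)" "r = of_int a / of_int b" by blast
  obtain c d where cd: "quotient_of r = (c, d)" by fastforce
  have d: "d > 0" "coprime c d" "r = of_int c / of_int d"
    using cd quotient_of_denom_pos quotient_of_coprime quotient_of_div by auto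
  have "b \<noteq> 0" using ab(1) by (rule coprime_prime_nonzero)
  then have "(of_int (a * d) :: rat) = of_int (c * b)"
    using d ab(2) by (simp add: field_simps)
  then have "a * d = c * b" by (simp only: of_int_eq_iff)
  then have "d dvd c * b" by (metis dvd_triv_right)
  then have "d dvd b" using d(2) by (simp add: coprime_dvd_mult_right_iff coprime_commute)
  then have "coprime d (int p)" using ab(1) by (rule coprime_divisors[OF _ dvd_refl])
  then show "r \<in> p_integral p" by (simp add: p_integral_def cd)
qed

lemma p_integral_divide_int:
  "coprime b (int p) \<Longrightarrow> of_int a / of_int b \<in> p_integral p"
  using p_integral_iff by blast

lemma p_integral_of_int: "of_int a \<in> p_integral p"
  using p_integral_divide_int[of 1 a] by simp

lemma p_integral_of_nat: "of_nat a \<in> p_integral p"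
  using p_integral_of_int[of "int a"] by simp

lemma p_integral_0: "0 \<in> p_integral p" and p_integral_1: "1 \<in> p_integral p"
  and p_integral_numeral: "numeral n \<in> p_integral p"
  using p_integral_of_int[of 0] p_integral_of_int[of 1] p_integral_of_int[of "numeral n"] by simp_all

lemma p_integral_mult: "a \<in> p_integral p \<Longrightarrow> b \<in> p_integral p \<Longrightarrow> a * b \<in> p_integral p"
proof -
  assume "a \<in> p_integral p" "b \<in> p_integral p"
  then obtain c d e f where "coprime d (int p)" "coprime f (int p)"
    and e: "a = of_int c / of_int d" "b = of_int e / of_int f"
    unfolding p_integral_iff by blast
  then have "coprime (d * f) (int p)" by simp
  moreover have "a * b = of_int (c * e) / of_int (d * f)" using e by simp
  ultimately show ?thesis using p_integral_iff by blast
qed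

lemma p_integral_add: "a \<in> p_integral p \<Longrightarrow> b \<in> p_integral p \<Longrightarrow> a + b \<in> p_integral p"
proof -
  assume "a \<in> p_integral p" "b \<in> p_integral p"
  then obtain c d e f where *: "coprime d (int p)" "coprime f (int p)"
    and e: "a = of_int c / of_int d" "b = of_int e / of_int f"
    unfolding p_integral_iff by blast
  then have "coprime (d * f) (int p)" by simp
  moreover have "d \<noteq> 0" "f \<noteq> 0" using * coprime_prime_nonzero by blast+
  then have "a + b = of_int (c * f + e * d) / of_int (d * f)" using e by (simp add: field_simps)
  ultimately show ?thesis using p_integral_iff by blast
qed

lemma p_integral_minus: "a \<in> p_integral p \<Longrightarrow> - a \<in> p_integral p"
  using p_integral_mult[OF p_integral_of_int[of "-1"]] by simp

lemma p_integral_diff: "a \<in> p_integral p \<Longrightarrow> b \<in> p_integral p \<Longrightarrow> a - b \<in> p_integral p"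
  using p_integral_add[of a "- b"] p_integral_minus by simp

lemma p_integral_power: "a \<in> p_integral p \<Longrightarrow> a ^ n \<in> p_integral p"
  by (induction n) (auto intro: p_integral_mult p_integral_1)

lemma p_integral_sum: "(\<And>i. i \<in> A \<Longrightarrow> f i \<in> p_integral p) \<Longrightarrow> sum f A \<in> p_integral p"
  by (induction A rule: infinite_finite_induct) (auto intro: p_integral_add p_integral_0)

lemma p_integral_prod: "(\<And>i. i \<in> A \<Longrightarrow> f i \<in> p_integral p) \<Longrightarrow> prod f A \<in> p_integral p"
  by (induction A rule: infinite_finite_induct) (auto intro: p_integral_mult p_integral_1)

lemmas p_integral_intros = p_integral_of_int p_integral_of_nat p_integral_0 p_integral_1
  p_integral_numeral p_integral_mult p_integral_add p_integral_minus p_integral_diff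
  p_integral_power p_integral_sum p_integral_prod

text \<open>Were \<open>p\<close> to divide the numerator, the fraction would be congruent to 0. So
  numerator and denominator are both prime to \<open>p\<close> and may change places.\<close>

lemma p_integral_inverse:
  assumes "a \<in> p_integral p" "\<not> pcong p 1 a 0"
  shows "inverse a \<in> p_integral p"
proof -
  obtain c d where cd: "coprime d (int p)" "a = of_int c / of_int d"
    using assms(1) p_integral_iff by blast
  have "\<not> int p dvd c"
  proof
    assume "int p dvd c"
    then obtain e where "c = int p * e" by blast
    then have "a - 0 = of_nat p ^ 1 * (of_int e / of_int d)" using cd by simp
    then show False using assms p_integral_divide_int[OF cd(1)] p_integral_0
      unfolding pcong_def by blast
  qed
  then have "coprime c (int p)" using p
    by (metis coprime_commute prime_imp_coprime prime_nat_int_transfer)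
  then show ?thesis using cd p_integral_divide_int[of c d] by simp
qed

lemma p_integral_divide:
  "b \<in> p_integral p \<Longrightarrow> a \<in> p_integral p \<Longrightarrow> \<not> pcong p 1 a 0 \<Longrightarrow> b / a \<in> p_integral p"
  by (metis divide_inverse p_integral_inverse p_integral_mult)

text \<open>Links congruence of rationals to divisibility of integers: the denominator of the
  witness is prime to \<open>p\<close> and cancels.\<close>

lemma pcong_int_iff: "pcong p 1 (of_int a) (of_int b) \<longleftrightarrow> int p dvd a - b"
proof
  assume "pcong p 1 (of_int a) (of_int b)"
  then obtain c where c: "c \<in> p_integral p" "of_int a - of_int b = of_nat p ^ 1 * c"
    unfolding pcong_def by blast
  obtain e d where cd: "coprime d (int p)" "c = of_int e / of_int d"
    using c(1) p_integral_iff by blast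
  have "d \<noteq> 0" using cd(1) by (rule coprime_prime_nonzero)
  then have "(of_int ((a - b) * d) :: rat) = of_int (int p * e)"
    using c(2) cd(2) by (simp add: field_simps)
  then have "(a - b) * d = int p * e" by (simp only: of_int_eq_iff)
  then have "int p dvd (a - b) * d" by simp
  then show "int p dvd a - b" using cd(1) by (simp add: coprime_dvd_mult_left_iff coprime_commute)
next
  assume "int p dvd a - b"
  then obtain e where "a - b = int p * e" by blast
  then have "of_int a - of_int b = (of_nat p ^ 1 * of_int e :: rat)"
    by (metis of_int_diff of_int_mult of_int_of_nat_eq power_one_right)
  then show "pcong p 1 (of_int a) (of_int b)"
    unfolding pcong_def using p_integral_of_int by blast
qed

lemma p_integral_inverse_nat:
  assumes "\<not> p dvd n"
  shows "1 / of_nat n \<in> p_integral p"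
  using p_integral_inverse[OF p_integral_of_nat, of n] pcong_int_iff[of "int n" 0] assms
  by (simp add: inverse_eq_divide)

section \<open>Calculus of congruences modulo powers of p\<close>

lemma pcongI: "b \<in> p_integral p \<Longrightarrow> c \<in> p_integral p \<Longrightarrow> a - b = of_nat p ^ m * c \<Longrightarrow> pcong p m a b"
proof -
  assume "b \<in> p_integral p" "c \<in> p_integral p" "a - b = of_nat p ^ m * c"
  moreover from this have "a = b + of_nat p ^ m * c" by simp
  moreover from calculation have "a \<in> p_integral p" by (auto intro!: p_integral_intros)
  ultimately show ?thesis unfolding pcong_def by blast
qed

lemma pcongE:
  assumes "pcong p m a b"
  obtains c where "a \<in> p_integral p" "b \<in> p_integral p" "c \<in> p_integral p" "a = b + of_nat p ^ m * c"
  using assms unfolding pcong_def by (metis add.commute diff_add_cancel)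

lemma pcong_refl: "a \<in> p_integral p \<Longrightarrow> pcong p m a a"
  by (rule pcongI[where c = 0]) (auto intro: p_integral_0)

text \<open>With the witness made explicit as a quotient, the additive rules below become closure
  properties of \<open>p_integral p\<close>.\<close>

lemma pcong_iff:
  "pcong p m a b \<longleftrightarrow> a \<in> p_integral p \<and> b \<in> p_integral p \<and> (a - b) / of_nat p ^ m \<in> p_integral p"
proof -
  have "p \<noteq> 0" using p by (auto intro: Nat.gr0I)
  then show ?thesis unfolding pcong_def
    by (auto simp: field_simps intro!: bexI[of _ "(a - b) / of_nat p ^ m"])
qed

lemma pcong_sym: "pcong p m a b \<Longrightarrow> pcong p m b a"
  using p_integral_minus[of "(a - b) / of_nat p ^ m"] by (simp add: pcong_iff diff_divide_distrib)

lemma pcong_add: "pcong p m a b \<Longrightarrow> pcong p m c d \<Longrightarrow> pcong p m (a + c) (b + d)"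
  using p_integral_add[of "(a - b) / of_nat p ^ m" "(c - d) / of_nat p ^ m"]
  by (simp add: pcong_iff p_integral_add add_divide_distrib diff_divide_distrib algebra_simps)

lemma pcong_trans [trans]: "pcong p m a b \<Longrightarrow> pcong p m b c \<Longrightarrow> pcong p m a c"
  using p_integral_add[of "(a - b) / of_nat p ^ m" "(b - c) / of_nat p ^ m"]
  by (simp add: pcong_iff diff_divide_distrib)

lemma pcong_minus: "pcong p m a b \<Longrightarrow> pcong p m (- a) (- b)"
  using p_integral_minus[of "(a - b) / of_nat p ^ m"]
  by (simp add: pcong_iff p_integral_minus diff_divide_distrib)

lemma pcong_diff: "pcong p m a b \<Longrightarrow> pcong p m c d \<Longrightarrow> pcong p m (a - c) (b - d)"
  using pcong_add[of m a b "- c" "- d"] pcong_minus[of m c d] by simp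

lemma pcong_mult:
  assumes "pcong p m a b" "pcong p m c d"
  shows "pcong p m (a * c) (b * d)"
proof -
  obtain u where u: "a \<in> p_integral p" "b \<in> p_integral p" "u \<in> p_integral p" "a = b + of_nat p ^ m * u"
    using assms(1) by (elim pcongE)
  obtain v where v: "c \<in> p_integral p" "d \<in> p_integral p" "v \<in> p_integral p" "c = d + of_nat p ^ m * v"
    using assms(2) by (elim pcongE)
  have "a * c - b * d = of_nat p ^ m * (u * c + b * v)"
    using u(4) v(4) by (simp add: algebra_simps)
  then show ?thesis using u(1-3) v(1-3)
    by (intro pcongI[of _ "u * c + b * v"] p_integral_intros)
qed

lemma pcong_cmult: "c \<in> p_integral p \<Longrightarrow> pcong p m a b \<Longrightarrow> pcong p m (c * a) (c * b)"
  by (intro pcong_mult pcong_refl)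

lemma pcong_sum: "(\<And>i. i \<in> A \<Longrightarrow> pcong p m (f i) (g i)) \<Longrightarrow> pcong p m (sum f A) (sum g A)"
  by (induction A rule: infinite_finite_induct) (auto intro: pcong_add pcong_refl p_integral_0)

lemma pcong_power_mult:
  assumes "pcong p m a b"
  shows "pcong p (j + m) (of_nat p ^ j * a) (of_nat p ^ j * b)"
  using assms
proof (rule pcongE)
  fix c assume "a \<in> p_integral p" "b \<in> p_integral p" "c \<in> p_integral p" "a = b + of_nat p ^ m * c"
  then show ?thesis
    by (intro pcongI[of _ c]) (auto intro!: p_integral_intros simp: algebra_simps power_add)
qed

lemma pcong_mono:
  assumes "pcong p m a b" "j \<le> m"
  shows "pcong p j a b"
  using assms(1)
proof (rule pcongE)
  fix c assume c: "a \<in> p_integral p" "b \<in> p_integral p" "c \<in> p_integral p" "a = b + of_nat p ^ m * c"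
  have "(of_nat p :: rat) ^ m = of_nat p ^ j * of_nat p ^ (m - j)"
    using assms(2) by (simp flip: power_add)
  then show ?thesis using c
    by (intro pcongI[of _ "of_nat p ^ (m - j) * c"]) (auto intro!: p_integral_intros)
qed

lemma pcong_0_mult_iff:
  assumes "a \<in> p_integral p" "b \<in> p_integral p"
  shows "pcong p 1 (a * b) 0 \<longleftrightarrow> pcong p 1 a 0 \<or> pcong p 1 b 0"
proof
  assume ab: "pcong p 1 (a * b) 0"
  show "pcong p 1 a 0 \<or> pcong p 1 b 0"
  proof (rule disjCI)
    assume b: "\<not> pcong p 1 b 0"
    then have "b \<noteq> 0" using pcong_refl[OF p_integral_0] by metis
    then show "pcong p 1 a 0"
      using pcong_mult[OF ab pcong_refl[OF p_integral_inverse[OF assms(2) b]]] by (simp add: mult.assoc)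
  qed
next
  show "pcong p 1 a 0 \<or> pcong p 1 b 0 \<Longrightarrow> pcong p 1 (a * b) 0"
    using pcong_mult[OF pcong_refl[OF assms(1)]] pcong_mult[OF _ pcong_refl[OF assms(2)]] by fastforce
qed

section \<open>Residue and quotient of a p-integral rational\<close>

lemma presidue_eq:
  assumes "r < p" "pcong p 1 x (of_nat r)"
  shows "presidue p x = r"
  unfolding presidue_def
proof (rule the_equality)
  fix s assume s: "s < p \<and> pcong p 1 x (of_nat s)"
  then have "pcong p 1 (of_int (int s)) (of_int (int r))"
    using pcong_trans[OF pcong_sym assms(2)] by simp
  then have "int p dvd int s - int r" by (simp only: pcong_int_iff)
  then show "s = r" using s assms(1)
    by (metis mod_eq_dvd_iff mod_less of_nat_mod of_nat_eq_iff)
qed (use assms in auto)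

lemma presidue:
  assumes "x \<in> p_integral p"
  shows "presidue p x < p" "pcong p 1 x (of_nat (presidue p x))"
proof -
  obtain a b where ab: "coprime b (int p)" "x = of_int a / of_int b"
    using assms p_integral_iff by blast
  have b: "b \<noteq> 0" using ab(1) by (rule coprime_prime_nonzero)
  have "coprime (int p) b" using ab(1) by (simp add: coprime_commute)
  then obtain u v where uv: "u * b + v * int p = 1"
    using bezout_int[of b "int p"] ab(1) by (metis coprime_imp_gcd_eq_1)
  \<comment> \<open>Bezout makes \<open>u\<close> an inverse of \<open>b\<close> modulo
    \<open>p\<close>, so \<open>a * u\<close> represents the residue class of
    \<open>a / b\<close>.\<close>
  define r where "r = nat ((a * u) mod int p)"
  have p0: "int p > 0" using p prime_gt_0_nat by simp
  have r: "int r = (a * u) mod int p" using p0 by (simp add: r_def)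
  have rp: "r < p" using p0 r by (metis of_nat_less_iff pos_mod_bound)
  have "int p dvd a * u - int r" using r by (simp add: minus_mod_eq_mult_div)
  then obtain e where e: "a * u - int r = int p * e" by blast
  have "a - int r * b = a * (u * b + v * int p) - int r * b" using uv by simp
  also have "\<dots> = (a * u - int r) * b + a * v * int p" by (simp add: algebra_simps)
  also have "\<dots> = int p * (e * b + a * v)" using e by (simp add: algebra_simps)
  finally have "(of_int (a - int r * b) :: rat) = of_int (int p * (e * b + a * v))" by simp
  then have "x - of_nat r = of_nat p ^ 1 * (of_int (e * b + a * v) / of_int b)"
    using ab(2) b by (simp add: field_simps)
  then have "pcong p 1 x (of_nat r)"
    by (intro pcongI[OF p_integral_of_nat p_integral_divide_int[OF ab(1)]])
  then show "presidue p x < p" "pcong p 1 x (of_nat (presidue p x))"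
    using presidue_eq[OF rp] rp by auto
qed

lemma pquot:
  assumes "x \<in> p_integral p"
  shows "pquot p x \<in> p_integral p" "x = of_nat (presidue p x) + of_nat p * pquot p x"
proof -
  have p0: "p > 0" using p prime_gt_0_nat by simp
  obtain c where c: "c \<in> p_integral p" "x - of_nat (presidue p x) = of_nat p ^ 1 * c"
    using presidue(2)[OF assms] unfolding pcong_def by blast
  then have "pquot p x = c" using p0 by (simp add: pquot_def)
  then show "pquot p x \<in> p_integral p" "x = of_nat (presidue p x) + of_nat p * pquot p x"
    using c by (auto simp: algebra_simps)
qed

end

section \<open>Binomial sums and their telescoping\<close>

text \<open>The P_k of the overview. It is invariant under x -> -1 - x and is a polynomial in
  x(x+1).\<close>

definition gchoose_pair :: "nat \<Rightarrow> 'a::field_char_0 \<Rightarrow> 'a" where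
  "gchoose_pair k x = (x gchoose k) * ((-1 - x) gchoose k)"

lemma gchoose_pair_0 [simp]: "gchoose_pair 0 x = 1"
  by (simp add: gchoose_pair_def)

lemma gbinomial_Suc_mult:
  "of_nat (Suc k) * (a gchoose Suc k) = (a - of_nat k) * (a gchoose k :: 'a::field_char_0)"
  using gbinomial_mult_1[of a k] by (simp add: algebra_simps)

text \<open>The two new factors multiply to (x - k)(-1 - x - k) = k(k+1) - x(x+1).\<close>

lemma gchoose_pair_Suc:
  "of_nat (Suc k) ^ 2 * gchoose_pair (Suc k) x = (of_nat k * of_nat (Suc k) - x * (x + 1)) * gchoose_pair k x"
proof -
  have "of_nat (Suc k) ^ 2 * gchoose_pair (Suc k) x
      = ((x - of_nat k) * (x gchoose k)) * ((-1 - x - of_nat k) * ((-1 - x) gchoose k))"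
    unfolding gchoose_pair_def power2_eq_square gbinomial_Suc_mult[symmetric]
    by (simp only: mult_ac)
  then show ?thesis by (simp add: gchoose_pair_def algebra_simps)
qed

lemma gchoose_pair_Suc':
  "gchoose_pair (Suc k) x
     = (of_nat k * of_nat (Suc k) - x * (x + 1)) * gchoose_pair k x / of_nat (Suc k) ^ 2"
  unfolding gchoose_pair_Suc[symmetric] by (simp del: of_nat_Suc)

text \<open>Dividing the recurrence by k+1 gives a P_k/(k+1) = k P_k - (k+1) P_{k+1} with a =
  x(x+1), so the sum telescopes.\<close>

lemma sum_gchoose_pair:
  "x * (x + 1) * (\<Sum>k<N. gchoose_pair k x / of_nat (Suc k)) = - of_nat N * gchoose_pair N x"
proof (induction N)
  case (Suc N)
  have s: "(of_nat (Suc N) :: 'a) \<noteq> 0" by (rule of_nat_neq_0)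
  have *: "- (n * s - a) * g / s = - n * g + a * (g / s)" if "s \<noteq> 0" for n s a g :: 'a
    using that by (simp add: divide_simps) (simp add: algebra_simps)
  have "- of_nat (Suc N) * gchoose_pair (Suc N) x
      = - (of_nat N * of_nat (Suc N) - x * (x + 1)) * gchoose_pair N x / of_nat (Suc N)"
    using s by (simp add: gchoose_pair_Suc' power2_eq_square del: of_nat_Suc minus_diff_eq)
  also have "\<dots> = - of_nat N * gchoose_pair N x + x * (x + 1) * (gchoose_pair N x / of_nat (Suc N))"
    by (rule *[OF s])
  finally show ?case using Suc by (simp add: distrib_left del: of_nat_Suc)
qed simp

section \<open>Summation over n in closed form\<close>

lemma of_nat_binomial_Suc:
  "of_nat (Suc k) * of_nat (n choose Suc k) = ((of_nat n - of_nat k) * of_nat (n choose k) :: 'a::field_char_0)"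
  using gbinomial_Suc_mult[of k "of_nat n :: 'a"] by (simp only: binomial_gbinomial)

text \<open>The right-hand side vanishes at \<open>N = 0\<close> and its forward difference in
  \<open>N\<close> is the summand; the induction step checks this after multiplication by
  k+1.\<close>

lemma sum_weighted_binomials:
  "(\<Sum>n<N. of_nat (2 * n + 1) * (of_nat (n choose k) * of_nat ((n + k) choose k)))
     = (of_nat N * of_nat (N choose Suc k) * of_nat ((N + k) choose k) :: 'a::field_char_0)"
proof (induction N)
  case (Suc N)
  have s: "(of_nat (Suc m) :: 'a) \<noteq> 0" for m by (rule of_nat_neq_0)
  have 1: "of_nat (Suc k) * of_nat (Suc N choose Suc k) = (of_nat (Suc N) * of_nat (N choose k) :: 'a)"
    by (metis Suc_times_binomial of_nat_mult)
  note 2 = of_nat_binomial_Suc[of k N, where ?'a = 'a]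
  have "Suc N * ((Suc N + k) choose k) = Suc (N + k) * ((N + k) choose k)"
    using binomial_absorb_comp[of "Suc N + k" k] by simp
  then have 3: "of_nat (Suc N) * of_nat ((Suc N + k) choose k) = (of_nat (Suc (N + k)) * of_nat ((N + k) choose k) :: 'a)"
    by (metis of_nat_mult)
  have "of_nat (Suc k) * (of_nat N * of_nat (N choose Suc k) * of_nat ((N + k) choose k)
      + of_nat (2 * N + 1) * (of_nat (N choose k) * of_nat ((N + k) choose k)))
    = of_nat (N choose k) * (of_nat (Suc N) * (of_nat (Suc (N + k)) * of_nat ((N + k) choose k)) :: 'a)"
  proof -
    have "s * (n * b' * c + m * (b * c)) = n * c * (s * b') + s * m * b * c" for s n b' c m b :: 'a
      by (simp add: algebra_simps)
    then show ?thesis by (simp only: 2) (simp add: algebra_simps)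
  qed
  also have "\<dots> = of_nat (Suc k) * (of_nat (Suc N) * of_nat (Suc N choose Suc k) * of_nat ((Suc N + k) choose k))"
    unfolding 3[symmetric] using 1 by (simp add: mult_ac)
  finally show ?case using Suc s[of k] by (simp del: of_nat_Suc binomial_Suc_Suc)
qed simp

text \<open>Apart from N/(k+1), the factors pair up as (N - i)(N + i)/i^2 = -(1 - N^2/i^2) for 1
  \<le> i \<le> k, and the sign absorbs the minus signs. For N = p every factor of the product is
  close to 1.\<close>

lemma signed_binomial_prod:
  "(-1) ^ k * (of_nat (N choose Suc k) * of_nat ((N + k) choose k))
     = of_nat N / of_nat (Suc k) * (\<Prod>i=1..k. 1 - of_nat N ^ 2 / of_nat i ^ 2 :: 'a::field_char_0)"
proof (induction k)
  case (Suc k)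
  have s: "(of_nat (Suc m) :: 'a) \<noteq> 0" for m by (rule of_nat_neq_0)
  note 2 = of_nat_binomial_Suc[of "Suc k" N, where ?'a = 'a]
  have "Suc k * ((N + Suc k) choose Suc k) = (N + Suc k) * ((N + k) choose k)"
    using Suc_times_binomial[of k "N + k"] by (simp del: binomial_Suc_Suc)
  then have 3: "of_nat (Suc k) * of_nat ((N + Suc k) choose Suc k) = (of_nat (N + Suc k) * of_nat ((N + k) choose k) :: 'a)"
    by (metis of_nat_mult)
  have "(of_nat (Suc (Suc k)) * of_nat (Suc k)) * ((-1) ^ Suc k * (of_nat (N choose Suc (Suc k)) * of_nat ((N + Suc k) choose Suc k)))
      = - ((of_nat N - of_nat (Suc k)) * of_nat (N + Suc k)) * ((-1) ^ k * (of_nat (N choose Suc k) * of_nat ((N + k) choose k)) :: 'a)"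
  proof -
    have "(s' * s) * ((-1) ^ Suc k * (b' * c')) = - ((-1) ^ k * ((s' * b') * (s * c')))" for s s' b' c' :: 'a
      by simp
    then show ?thesis by (simp only: 2 3) (simp add: mult_ac del: of_nat_Suc)
  qed
  also have "\<dots> = (of_nat (Suc k) ^ 2 - of_nat N ^ 2) * (of_nat N / of_nat (Suc k) * (\<Prod>i=1..k. 1 - of_nat N ^ 2 / of_nat i ^ 2))"
    unfolding Suc by (simp add: algebra_simps power2_eq_square)
  also have "\<dots> = (of_nat (Suc (Suc k)) * of_nat (Suc k)) * (of_nat N / of_nat (Suc (Suc k)) * (\<Prod>i=1..Suc k. 1 - of_nat N ^ 2 / of_nat i ^ 2))"
    using s[of k] s[of "Suc k"] by (simp add: field_simps power2_eq_square del: of_nat_Suc)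
  finally show ?case by (simp only: mult_cancel_left mult_eq_0_iff s simp_thms)
qed simp

lemma weighted_sum_Vpoly:
  "(\<Sum>n<N. of_nat (2 * n + 1) * Vpoly n x)
     = of_nat N ^ 2 * (\<Sum>k<N. (\<Prod>i=1..k. 1 - of_nat N ^ 2 / of_nat i ^ 2) *
         (gchoose_pair k x / of_nat (Suc k)))"
proof -
  have "(\<Sum>n<N. of_nat (2 * n + 1) * Vpoly n x)
      = (\<Sum>n<N. \<Sum>k<N. of_nat (2 * n + 1) * (of_nat (n choose k) * of_nat ((n + k) choose k)) * ((-1) ^ k * gchoose_pair k x))"
  proof (rule sum.cong[OF refl])
    fix n assume "n \<in> {..<N}"
    then have "Vpoly n x = (\<Sum>k<N. of_nat (n choose k) * of_nat ((n + k) choose k) * (-1) ^ k *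
       (x gchoose k) * ((-1 - x) gchoose k))"
      unfolding Vpoly_def by (intro sum.mono_neutral_left) auto
    then show "of_nat (2 * n + 1) * Vpoly n x = (\<Sum>k<N. of_nat (2 * n + 1) * (of_nat (n choose k) * of_nat ((n + k) choose k)) * ((-1) ^ k * gchoose_pair k x))"
      by (simp only: sum_distrib_left gchoose_pair_def mult_ac)
  qed
  also have "\<dots> = (\<Sum>k<N. (\<Sum>n<N. of_nat (2 * n + 1) * (of_nat (n choose k) * of_nat ((n + k) choose k))) * ((-1) ^ k * gchoose_pair k x))"
    by (subst sum.swap) (simp only: sum_distrib_right)
  also have "\<dots> = (\<Sum>k<N. of_nat N * ((-1) ^ k * (of_nat (N choose Suc k) * of_nat ((N + k) choose k))) * gchoose_pair k x)"
    unfolding sum_weighted_binomials by (simp only: mult_ac)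
  also have "\<dots> = (\<Sum>k<N. of_nat N ^ 2 * ((\<Prod>i=1..k. 1 - of_nat N ^ 2 / of_nat i ^ 2) *
         (gchoose_pair k x / of_nat (Suc k))))"
    unfolding signed_binomial_prod by (simp add: power2_eq_square mult_ac)
  finally show ?thesis by (simp only: sum_distrib_left)
qed

text \<open>Summation by parts: a P_k/(k+1) is the difference k P_k - (k+1) P_{k+1}, and the partial
  sums of 1/i^2 grow by 1/k^2, which leaves k P_k/k^2 = P_k/k and one boundary term.\<close>

lemma sum_H2_gchoose_pair:
  "x * (x + 1) * (\<Sum>k<Suc N. (\<Sum>i=1..k. 1 / of_nat i ^ 2) * (gchoose_pair k x / of_nat (Suc k)))
     = (\<Sum>k=1..N. gchoose_pair k x / of_nat k)
       - (\<Sum>i=1..N. 1 / of_nat i ^ 2) * of_nat (Suc N) * gchoose_pair (Suc N) x"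
proof (induction N)
  case (Suc N)
  have s: "(of_nat (Suc m) :: 'a) \<noteq> 0" for m by (rule of_nat_neq_0)
  define h :: 'a where "h = (\<Sum>i=1..N. 1 / of_nat i ^ 2)"
  define g where "g = gchoose_pair (Suc N) x"
  define a where "a = x * (x + 1)"
  have h: "(\<Sum>i=1..Suc N. 1 / of_nat i ^ 2) = h + 1 / of_nat (Suc N) ^ 2" by (simp add: h_def)
  define t where "t = (\<Sum>k<Suc N. (\<Sum>i=1..k. 1 / of_nat i ^ 2) * (gchoose_pair k x / of_nat (Suc k)))"
  define e where "e = (\<Sum>k=1..N. gchoose_pair k x / of_nat k)"
  have IH: "a * t = e - h * of_nat (Suc N) * g"
    using Suc unfolding a_def t_def e_def h_def g_def .
  have t: "(\<Sum>k<Suc (Suc N). (\<Sum>i=1..k. 1 / of_nat i ^ 2) * (gchoose_pair k x / of_nat (Suc k)))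
      = t + (h + 1 / of_nat (Suc N) ^ 2) * (g / of_nat (Suc (Suc N)))"
    by (subst sum.lessThan_Suc) (simp only: t_def g_def h)
  have e: "(\<Sum>k=1..Suc N. gchoose_pair k x / of_nat k) = e + g / of_nat (Suc N)"
    by (simp add: e_def g_def)
  have "gchoose_pair (Suc (Suc N)) x = (of_nat (Suc N) * of_nat (Suc (Suc N)) - a) * g / of_nat (Suc (Suc N)) ^ 2"
    unfolding a_def g_def by (rule gchoose_pair_Suc')
  then have g: "(h + 1 / of_nat (Suc N) ^ 2) * of_nat (Suc (Suc N)) * gchoose_pair (Suc (Suc N)) x
     = (h + 1 / of_nat (Suc N) ^ 2) * ((of_nat (Suc N) * of_nat (Suc (Suc N)) - a) * g / of_nat (Suc (Suc N)))"
    using s[of "Suc N"] by (simp add: power2_eq_square del: of_nat_Suc)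
  have *: "(h + 1 / s ^ 2) * ((s * s' - a) * g / s') = h * s * g + g / s - a * ((h + 1 / s ^ 2) * (g / s'))"
    if "s \<noteq> 0" "s' \<noteq> 0" for s s' :: 'a
    using that by (simp add: divide_simps power2_eq_square) (simp add: algebra_simps)
  show ?case
    unfolding t h e g a_def[symmetric] distrib_left[of a] IH *[OF s s] by simp
qed simp

section \<open>The sum of P_k/k at natural numbers\<close>

lemma gchoose_pair_Suc_prod:
  "of_nat (Suc k) ^ 2 * gchoose_pair (Suc k) x
     = - x * (of_nat (Suc k) + x) * (\<Prod>i=1..k. 1 - x ^ 2 / of_nat i ^ 2)"
proof (induction k)
  case 0
  then show ?case by (simp add: gchoose_pair_def algebra_simps)
next
  case (Suc k)
  have s: "(of_nat (Suc k) :: 'a) \<noteq> 0" by (rule of_nat_neq_0)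
  have "of_nat (Suc (Suc k)) ^ 2 * gchoose_pair (Suc (Suc k)) x
      = (of_nat (Suc k) - x) * (of_nat (Suc (Suc k)) + x) * gchoose_pair (Suc k) x"
    unfolding gchoose_pair_Suc by (simp add: algebra_simps)
  also have "gchoose_pair (Suc k) x = - x * (of_nat (Suc k) + x) * (\<Prod>i=1..k. 1 - x ^ 2 / of_nat i ^ 2) / of_nat (Suc k) ^ 2"
    using s unfolding Suc[symmetric] by (simp del: of_nat_Suc)
  also have "(of_nat (Suc k) - x) * (of_nat (Suc (Suc k)) + x) * \<dots>
      = - x * (of_nat (Suc (Suc k)) + x) * ((\<Prod>i=1..k. 1 - x ^ 2 / of_nat i ^ 2) * (1 - x ^ 2 / of_nat (Suc k) ^ 2))"
    using s by (simp add: field_simps power2_eq_square del: of_nat_Suc)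
  finally show ?case by simp
qed

lemma gchoose_pair_reflect: "gchoose_pair k (-1 - x) = gchoose_pair k x"
  by (simp add: gchoose_pair_def mult.commute)

lemma gchoose_pair_diff:
  "x * (gchoose_pair (Suc k) x - gchoose_pair (Suc k) (x - 1)) / of_nat (Suc k)
     = 2 * ((\<Prod>i=1..Suc k. 1 - x ^ 2 / of_nat i ^ 2) - (\<Prod>i=1..k. 1 - x ^ 2 / of_nat i ^ 2))"
proof -
  have s: "(of_nat (Suc k) :: 'a) \<noteq> 0" by (rule of_nat_neq_0)
  define g where "g = (\<Prod>i=1..k. 1 - x ^ 2 / of_nat i ^ 2)"
  have 1: "gchoose_pair (Suc k) x = - x * (of_nat (Suc k) + x) * g / of_nat (Suc k) ^ 2"
    unfolding g_def gchoose_pair_Suc_prod[symmetric] using s by (simp del: of_nat_Suc)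
  \<comment> \<open>Reflection exchanges x - 1 with -x, and the product is even in x. Only the
    linear factors distinguish the two values.\<close>
  have "of_nat (Suc k) ^ 2 * gchoose_pair (Suc k) (x - 1) = x * (of_nat (Suc k) - x) * g"
    using gchoose_pair_Suc_prod[of k "- x"] gchoose_pair_reflect[of "Suc k" "x - 1"] by (simp add: g_def)
  then have 2: "gchoose_pair (Suc k) (x - 1) = x * (of_nat (Suc k) - x) * g / of_nat (Suc k) ^ 2"
    using s by (simp add: field_simps del: of_nat_Suc)
  have 3: "(\<Prod>i=1..Suc k. 1 - x ^ 2 / of_nat i ^ 2) = g * (1 - x ^ 2 / of_nat (Suc k) ^ 2)"
    by (simp add: g_def)
  show ?thesis unfolding 1 2 3 g_def[symmetric] using s by (simp add: field_simps power2_eq_square del: of_nat_Suc)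
qed

text \<open>Each summand is a difference of consecutive partial products, so lowering the argument
  by 1 changes the sum by a single product.\<close>

lemma sum_gchoose_pair_diff:
  "x * ((\<Sum>k=1..N. gchoose_pair k x / of_nat k) - (\<Sum>k=1..N. gchoose_pair k (x - 1) / of_nat k))
     = 2 * ((\<Prod>i=1..N. 1 - x ^ 2 / of_nat i ^ 2) - 1)"
proof (induction N)
  case (Suc N)
  have "x * ((\<Sum>k=1..Suc N. gchoose_pair k x / of_nat k) - (\<Sum>k=1..Suc N. gchoose_pair k (x - 1) / of_nat k))
    = x * ((\<Sum>k=1..N. gchoose_pair k x / of_nat k) - (\<Sum>k=1..N. gchoose_pair k (x - 1) / of_nat k))
      + x * (gchoose_pair (Suc N) x - gchoose_pair (Suc N) (x - 1)) / of_nat (Suc N)"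
    by (simp add: ring_distribs diff_divide_distrib del: of_nat_Suc)
  then show ?case unfolding Suc gchoose_pair_diff by (simp add: algebra_simps)
qed simp

text \<open>At x = r+1 \<le> N the product contains the zero factor i = r+1. Passing from r to r+1
  therefore adds exactly -2/(r+1), starting from 0 at r = 0.\<close>

lemma sum_gchoose_pair_of_nat:
  "r \<le> N \<Longrightarrow> (\<Sum>k=1..N. gchoose_pair k (of_nat r) / of_nat k) = - 2 * H r"
proof (induction r)
  case 0
  have "gchoose_pair k (0 :: rat) = 0" if "k \<ge> 1" for k
    using that by (simp add: gchoose_pair_def gbinomial_0_left)
  then show ?case by (simp add: H_def)
next
  case (Suc r)
  have s: "(of_nat (Suc r) :: rat) \<noteq> 0" by (rule of_nat_neq_0)
  have "(\<Prod>i=1..N. 1 - of_nat (Suc r) ^ 2 / of_nat i ^ 2) = (0 :: rat)"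
    using Suc.prems by (intro prod_zero bexI[of _ "Suc r"]) (auto simp del: of_nat_Suc)
  then have "of_nat (Suc r) * ((\<Sum>k=1..N. gchoose_pair k (of_nat (Suc r)) / of_nat k)
      - (\<Sum>k=1..N. gchoose_pair k (of_nat (Suc r) - 1) / of_nat k)) = (- 2 :: rat)"
    unfolding sum_gchoose_pair_diff by simp
  moreover have "(of_nat (Suc r) - 1 :: rat) = of_nat r" by simp
  ultimately have "of_nat (Suc r) * ((\<Sum>k=1..N. gchoose_pair k (of_nat (Suc r)) / of_nat k) + 2 * H r) = (- 2 :: rat)"
    using Suc by (simp del: of_nat_Suc)
  then have "(\<Sum>k=1..N. gchoose_pair k (of_nat (Suc r)) / of_nat k) + 2 * H r = - 2 / of_nat (Suc r)"
    by (metis s nonzero_mult_div_cancel_left)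
  moreover have "H (Suc r) = H r + 1 / of_nat (Suc r)" by (simp add: H_def)
  ultimately show ?case by (simp del: of_nat_Suc)
qed

section \<open>Recurrences for \<open>Vpoly\<close> and \<open>Vseq\<close>\<close>

lemma gchoose_pair_of_nat:
  "gchoose_pair k (of_nat n) = (-1) ^ k * (of_nat (n choose k) * of_nat ((n + k) choose k))"
proof -
  have "(-1 - of_nat n :: 'a) = - of_nat (Suc n)" by simp
  then have "((-1 - of_nat n :: 'a) gchoose k) = (-1) ^ k * ((of_nat (Suc n) + of_nat k - 1) gchoose k)"
    by (simp only: gbinomial_minus)
  also have "(of_nat (Suc n) + of_nat k - 1 :: 'a) = of_nat (n + k)" by simp
  finally show ?thesis by (simp add: gchoose_pair_def binomial_gbinomial)
qed

text \<open>In this form \<open>n\<close> enters only as the argument of a second pair, so a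
  recurrence in \<open>n\<close> can be read off from shifts of that argument. The free bound
  \<open>m\<close> lets neighbouring values of \<open>n\<close> share one summation range.\<close>

lemma Vpoly_gchoose_pair:
  assumes "n < m"
  shows "Vpoly n x = (\<Sum>k<m. gchoose_pair k x * gchoose_pair k (of_nat n))"
proof -
  have "Vpoly n x = (\<Sum>k=0..n. gchoose_pair k x * gchoose_pair k (of_nat n))"
    unfolding Vpoly_def gchoose_pair_of_nat by (simp only: gchoose_pair_def mult_ac)
  also have "\<dots> = (\<Sum>k<m. gchoose_pair k x * gchoose_pair k (of_nat n))"
    using assms by (intro sum.mono_neutral_left) (auto simp: gchoose_pair_of_nat)
  finally show ?thesis .
qed

lemma gchoose_pair_Suc_add_1:
  "of_nat (Suc k) ^ 2 * gchoose_pair (Suc k) (y + 1)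
     = - (y + of_nat (Suc (Suc k))) * (y + of_nat (Suc k)) * gchoose_pair k y"
proof -
  have 1: "of_nat (Suc k) * ((y + 1) gchoose Suc k) = (y + 1) * (y gchoose k)"
    using gbinomial_absorption[of k "y + 1"] by simp
  have 2: "of_nat (Suc k) * ((-1 - (y + 1)) gchoose Suc k) = (-2 - y - of_nat k) * ((-2 - y) gchoose k)"
  proof -
    have "-1 - (y + 1) = -2 - y" by simp
    then show ?thesis by (simp only: gbinomial_Suc_mult)
  qed
  have 3: "(-1 - y) * ((-2 - y) gchoose k) = (-1 - y - of_nat k) * ((-1 - y) gchoose k)"
  proof -
    have "-1 - y - 1 = -2 - y" by simp
    then show ?thesis using gbinomial_absorption[of k "-1 - y"] by (simp only: gbinomial_Suc_mult)
  qed
  have "of_nat (Suc k) ^ 2 * gchoose_pair (Suc k) (y + 1)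
      = (of_nat (Suc k) * ((y + 1) gchoose Suc k)) * (of_nat (Suc k) * ((-1 - (y + 1)) gchoose Suc k))"
    by (simp only: gchoose_pair_def power2_eq_square mult_ac)
  also have "\<dots> = (y + of_nat (Suc (Suc k))) * (y gchoose k) * ((-1 - y) * ((-2 - y) gchoose k))"
    unfolding 1 2 by (simp add: algebra_simps)
  finally show ?thesis unfolding 3 by (simp add: gchoose_pair_def algebra_simps)
qed

text \<open>The reflection y -> -1 - y turns the shift by -1 into a shift by +1.\<close>

lemma gchoose_pair_Suc_minus_1:
  "of_nat (Suc k) ^ 2 * gchoose_pair (Suc k) (y - 1)
     = - (of_nat (Suc k) - y) * (of_nat k - y) * gchoose_pair k y"
proof -
  have "gchoose_pair (Suc k) (y - 1) = gchoose_pair (Suc k) ((-1 - y) + 1)"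
    using gchoose_pair_reflect[of "Suc k" "y - 1"] by simp
  then show ?thesis
    using gchoose_pair_Suc_add_1[of k "-1 - y"] by (simp add: gchoose_pair_reflect)
qed

text \<open>All values at index k+1 are multiples of \<open>gchoose_pair k y\<close> with
  denominator (k+1)^2. Clearing it leaves a polynomial identity in y and k.\<close>

lemma gchoose_pair_recurrence:
  "(y + 1) ^ 3 * gchoose_pair (Suc k) (y + 1) + y ^ 3 * gchoose_pair (Suc k) (y - 1)
     = (2 * y + 1) * ((y ^ 2 + y + 1 + 2 * of_nat (Suc k) * of_nat (Suc (Suc k))) * gchoose_pair (Suc k) y
         - 2 * of_nat (Suc k) ^ 2 * gchoose_pair k y)"
proof -
  define c :: 'a where "c = of_nat (Suc k) ^ 2"
  have c: "c \<noteq> 0" unfolding c_def by (simp del: of_nat_Suc)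
  define l :: 'a where "l = of_nat k"
  have ck: "c = (l + 1) ^ 2" by (simp add: c_def l_def add.commute)
  define q where "q = gchoose_pair k y"
  have 1: "c * gchoose_pair (Suc k) (y + 1) = - (y + l + 2) * (y + l + 1) * q"
    using gchoose_pair_Suc_add_1[of k y] by (simp add: c_def l_def q_def algebra_simps)
  have 2: "c * gchoose_pair (Suc k) (y - 1) = - (l + 1 - y) * (l - y) * q"
    using gchoose_pair_Suc_minus_1[of k y] by (simp add: c_def l_def q_def algebra_simps)
  have 3: "c * gchoose_pair (Suc k) y = (l * (l + 1) - y * (y + 1)) * q"
    using gchoose_pair_Suc[of k y] by (simp add: c_def l_def q_def algebra_simps)
  have "c * ((y + 1) ^ 3 * gchoose_pair (Suc k) (y + 1) + y ^ 3 * gchoose_pair (Suc k) (y - 1))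
      = (y + 1) ^ 3 * (c * gchoose_pair (Suc k) (y + 1)) + y ^ 3 * (c * gchoose_pair (Suc k) (y - 1))"
    by (simp add: algebra_simps)
  also have "\<dots> = (2 * y + 1) * ((y ^ 2 + y + 1 + 2 * (l + 1) * (l + 2)) * (c * gchoose_pair (Suc k) y) - 2 * c * c * q)"
    unfolding 1 2 3 unfolding ck by algebra
  also have "\<dots> = c * ((2 * y + 1) * ((y ^ 2 + y + 1 + 2 * (l + 1) * (l + 2)) * gchoose_pair (Suc k) y - 2 * c * q))"
    by (simp add: algebra_simps)
  finally show ?thesis using c by (simp add: c_def l_def q_def add.commute)
qed

text \<open>Sum the relation for the second factor against P_k(x) and shift the index of its last
  term. Then 2k(k+1) P_k(x) - 2(k+1)^2 P_{k+1}(x) = 2x(x+1) P_k(x) removes k from the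
  coefficients.\<close>

lemma Vpoly_recurrence:
  fixes x :: "'a::field_char_0" and n :: nat
  defines "y \<equiv> of_nat (Suc n)"
  shows "(y + 1) ^ 3 * Vpoly (Suc (Suc n)) x
     = (2 * y + 1) * (y ^ 2 + y + 1 + 2 * (x * (x + 1))) * Vpoly (Suc n) x - y ^ 3 * Vpoly n x"
proof -
  define K where "K = Suc (Suc n)"
  define T where "T k = (y + 1) ^ 3 * gchoose_pair k (y + 1) + y ^ 3 * gchoose_pair k (y - 1)" for k
  have "(y + 1) ^ 3 * Vpoly (Suc (Suc n)) x + y ^ 3 * Vpoly n x = (\<Sum>k<Suc K. gchoose_pair k x * T k)"
  proof -
    have "of_nat (Suc (Suc n)) = y + 1" "of_nat n = y - 1" by (simp_all add: y_def)
    then have "Vpoly (Suc (Suc n)) x = (\<Sum>k<Suc K. gchoose_pair k x * gchoose_pair k (y + 1))"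
      "Vpoly n x = (\<Sum>k<Suc K. gchoose_pair k x * gchoose_pair k (y - 1))"
      using Vpoly_gchoose_pair[of "Suc (Suc n)" "Suc K" x] Vpoly_gchoose_pair[of n "Suc K" x]
      by (simp_all only: K_def)
    then show ?thesis unfolding T_def
      by (simp only: sum_distrib_left distrib_left sum.distrib mult.left_commute)
  qed
  \<comment> \<open>Index 0 is split off because the pointwise relation covers successor indices
    only; its contribution is restored when the range is extended again below.\<close>
  also have "\<dots> = T 0 + (\<Sum>k<K. gchoose_pair (Suc k) x * T (Suc k))"
    by (subst sum.lessThan_Suc_shift) simp
  also have "T 0 = (2 * y + 1) * (y ^ 2 + y + 1)"
    unfolding T_def gchoose_pair_0 by algebra
  also have "(\<Sum>k<K. gchoose_pair (Suc k) x * T (Suc k))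
     = (2 * y + 1) * ((\<Sum>k<K. (y ^ 2 + y + 1 + 2 * of_nat (Suc k) * of_nat (Suc (Suc k))) * gchoose_pair (Suc k) x * gchoose_pair (Suc k) y)
         - (\<Sum>k<K. 2 * (of_nat (Suc k) ^ 2 * gchoose_pair (Suc k) x) * gchoose_pair k y))"
    unfolding T_def gchoose_pair_recurrence sum_subtractf[symmetric] sum_distrib_left
    by (intro sum.cong refl) (simp add: algebra_simps)
  also have "(\<Sum>k<K. (y ^ 2 + y + 1 + 2 * of_nat (Suc k) * of_nat (Suc (Suc k))) * gchoose_pair (Suc k) x * gchoose_pair (Suc k) y)
     = (\<Sum>k<Suc K. (y ^ 2 + y + 1 + 2 * of_nat k * of_nat (Suc k)) * gchoose_pair k x * gchoose_pair k y) - (y ^ 2 + y + 1)"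
    by (subst sum.lessThan_Suc_shift) simp
  \<comment> \<open>The term k = K = n+2 vanishes, as K exceeds y = n+1.\<close>
  also have "(\<Sum>k<Suc K. (y ^ 2 + y + 1 + 2 * of_nat k * of_nat (Suc k)) * gchoose_pair k x * gchoose_pair k y)
     = (\<Sum>k<K. (y ^ 2 + y + 1 + 2 * of_nat k * of_nat (Suc k)) * gchoose_pair k x * gchoose_pair k y)"
    unfolding y_def K_def by (simp add: gchoose_pair_of_nat binomial_eq_0 del: of_nat_Suc binomial_Suc_Suc)
  finally have "(y + 1) ^ 3 * Vpoly (Suc (Suc n)) x + y ^ 3 * Vpoly n x
     = (2 * y + 1) * ((\<Sum>k<K. (y ^ 2 + y + 1 + 2 * of_nat k * of_nat (Suc k)) * gchoose_pair k x * gchoose_pair k y)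
         - (\<Sum>k<K. 2 * (of_nat (Suc k) ^ 2 * gchoose_pair (Suc k) x) * gchoose_pair k y))"
    by (simp add: algebra_simps)
  also have "\<dots> = (2 * y + 1) * ((y ^ 2 + y + 1 + 2 * (x * (x + 1))) * (\<Sum>k<K. gchoose_pair k x * gchoose_pair k y))"
    unfolding gchoose_pair_Suc sum_subtractf[symmetric] sum_distrib_left[of "y ^ 2 + y + 1 + 2 * (x * (x + 1))"]
    by (intro arg_cong[where f = "\<lambda>t. (2 * y + 1) * t"] sum.cong refl) (simp add: algebra_simps)
  also have "(\<Sum>k<K. gchoose_pair k x * gchoose_pair k y) = Vpoly (Suc n) x"
    unfolding y_def K_def by (rule Vpoly_gchoose_pair[symmetric]) simp
  finally show ?thesis by (simp add: algebra_simps)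
qed

section \<open>The recurrence of \<open>Vseq\<close> from its generating function\<close>

text \<open>The Euler operator z d/dz. It multiplies the n-th coefficient by n, so recurrences with
  polynomial coefficients become differential equations.\<close>

definition fps_theta :: "'a::comm_ring_1 fps \<Rightarrow> 'a fps" where
  "fps_theta f = fps_X * fps_deriv f"

lemma fps_theta_nth [simp]: "fps_nth (fps_theta f) n = of_nat n * fps_nth f n"
  by (cases n) (simp_all add: fps_theta_def)

lemma fps_theta_add: "fps_theta (f + g) = fps_theta f + fps_theta g"
  and fps_theta_mult: "fps_theta (f * g) = fps_theta f * g + f * fps_theta g"
  and fps_theta_numeral: "fps_theta (numeral m) = 0"
  and fps_theta_X: "fps_theta fps_X = fps_X"
  by (simp_all add: fps_theta_def algebra_simps)

text \<open>The symmetric square of a second-order equation: \<open>y0\<close> to \<open>y3\<close>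
  stand for the iterated Euler derivatives of a solution, \<open>s0\<close> to \<open>s3\<close> for
  those of its square. As a ring identity it involves no division.\<close>

lemma square_ode:
  fixes z :: "'a::comm_ring_1"
  assumes "(1 - 16 * z) * y2 = z * (16 * y1 + 4 * y0)"
    and "(1 - 16 * z) * y3 = z * (32 * y2 + 20 * y1 + 4 * y0)"
    and "s0 = y0 * y0" "s1 = 2 * y0 * y1" "s2 = 2 * y1 * y1 + 2 * y0 * y2" "s3 = 6 * y1 * y2 + 2 * y0 * y3"
  shows "s3 - z * (32 * s3 + 48 * s2 + 32 * s1 + 8 * s0) + 256 * z * z * (s3 + 3 * s2 + 3 * s1 + s0) = 0"
proof -
  \<comment> \<open>The total coefficient of \<open>s3\<close> is 1 - 32 z + 256 z^2 = A^2, which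
    supplies a factor A for eliminating \<open>y3\<close> and another for \<open>y2\<close>.\<close>
  define A where "A = 1 - 16 * z"
  have "s3 - z * (32 * s3 + 48 * s2 + 32 * s1 + 8 * s0) + 256 * z * z * (s3 + 3 * s2 + 3 * s1 + s0)
     = 6 * A * y1 * (A * y2) + 2 * A * y0 * (A * y3) - 96 * z * A * y1 * y1 - 96 * z * y0 * (A * y2)
       + (1536 * z * z - 64 * z) * y0 * y1 + (256 * z * z - 8 * z) * y0 * y0"
    unfolding assms(3-) A_def by (simp add: algebra_simps)
  also have "\<dots> = 6 * A * y1 * (A * y2) + 2 * y0 * z * (32 * (A * y2) + 20 * A * y1 + 4 * A * y0)
       - 96 * z * A * y1 * y1 - 96 * z * y0 * (A * y2)
       + (1536 * z * z - 64 * z) * y0 * y1 + (256 * z * z - 8 * z) * y0 * y0"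
    unfolding assms(2)[folded A_def] by (simp add: algebra_simps)
  also have "\<dots> = 0"
    unfolding assms(1)[folded A_def] unfolding A_def by (simp add: algebra_simps)
  finally show ?thesis .
qed

lemma central_binomial_Suc:
  "of_nat (Suc n) * of_nat (2 * Suc n choose Suc n) = (2 * (2 * of_nat n + 1) * of_nat (2 * n choose n) :: 'a::comm_ring_1)"
proof -
  have "Suc n * (2 * Suc n choose Suc n) = 2 * (2 * n + 1) * (2 * n choose n)"
  proof -
    have "Suc n * (2 * Suc n choose Suc n) = 2 * (Suc n * (2 * n + 1 choose n))"
      using Suc_times_binomial[of n "2 * n + 1"] by (simp del: binomial_Suc_Suc)
    also have "(2 * n + 1 choose n) = (2 * n + 1 choose Suc n)"
      by (subst binomial_symmetric) auto
    also have "Suc n * \<dots> = (2 * n + 1) * (2 * n choose n)"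
      using Suc_times_binomial[of n "2 * n"] by (simp del: binomial_Suc_Suc)
    finally show ?thesis by simp
  qed
  then show ?thesis by (metis (mono_tags) of_nat_1 of_nat_add of_nat_mult of_nat_numeral)
qed

text \<open>\<open>Vseq\<close> is the self-convolution of the squared central binomial
  coefficients, so its generating function is a square to which \<open>square_ode\<close>
  applies.\<close>

lemma Vseq_recurrence:
  fixes n :: nat
  defines "y \<equiv> (of_nat (Suc n) :: rat)"
  shows "(y + 1) ^ 3 * of_nat (Vseq (Suc (Suc n)))
     = 8 * (2 * y + 1) * (2 * y ^ 2 + 2 * y + 1) * of_nat (Vseq (Suc n)) - 256 * y ^ 3 * of_nat (Vseq n)"
proof -
  define f :: "rat fps" where "f = Abs_fps (\<lambda>n. of_nat (2 * n choose n) ^ 2)"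
  define s where "s = f * f"
  have s: "fps_nth s m = of_nat (Vseq m)" for m
    unfolding s_def f_def fps_mult_nth Vseq_def by (simp add: diff_mult_distrib2)
  let ?t = "fps_theta :: rat fps \<Rightarrow> rat fps"
  \<comment> \<open>This encodes (m+1)^2 c_{m+1} = 4(2m+1)^2 c_m for the squared central binomials
    c_m, with 4(2m+1)^2 = 16m^2 + 16m + 4.\<close>
  have ode: "?t (?t f) = fps_X * (16 * ?t (?t f) + 16 * ?t f + 4 * f)"
  proof (rule fps_ext)
    fix m show "fps_nth (?t (?t f)) m = fps_nth (fps_X * (16 * ?t (?t f) + 16 * ?t f + 4 * f)) m"
    proof (cases m)
      case (Suc m')
      have "of_nat (Suc m') ^ 2 * of_nat (2 * Suc m' choose Suc m') ^ 2 = (2 * (2 * of_nat m' + 1) * of_nat (2 * m' choose m') :: rat) ^ 2"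
        unfolding central_binomial_Suc[symmetric] by (simp add: power_mult_distrib)
      then show ?thesis unfolding Suc
        by (simp add: f_def power2_eq_square algebra_simps numeral_fps_const)
    qed simp
  qed
  have "?t (?t (?t f)) = ?t (fps_X * (16 * ?t (?t f) + 16 * ?t f + 4 * f))"
    using ode by simp
  then have ode': "(1 - 16 * fps_X) * ?t (?t (?t f)) = fps_X * (32 * ?t (?t f) + 20 * ?t f + 4 * f)"
    by (simp add: fps_theta_add fps_theta_mult fps_theta_numeral fps_theta_X algebra_simps)
  have t1: "?t s = 2 * f * ?t f"
    by (simp add: s_def fps_theta_mult)
  have t2: "?t (?t s) = 2 * ?t f * ?t f + 2 * f * ?t (?t f)"
    unfolding t1 by (simp add: fps_theta_mult fps_theta_numeral)
  have t3: "?t (?t (?t s)) = 6 * ?t f * ?t (?t f) + 2 * f * ?t (?t (?t f))"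
    unfolding t2 by (simp add: fps_theta_add fps_theta_mult fps_theta_numeral algebra_simps)
  have ode0: "(1 - 16 * fps_X) * ?t (?t f) = fps_X * (16 * ?t f + 4 * f)"
    using ode by (simp add: algebra_simps)
  note 0 = square_ode[OF ode0 ode' s_def t1 t2 t3]
  \<comment> \<open>The multipliers 1, X and X^2 make the coefficient of X^(n+2) a relation between
    the values of \<open>Vseq\<close> at n+2, n+1 and n.\<close>
  have "fps_nth (?t (?t (?t s)) - fps_X * (32 * ?t (?t (?t s)) + 48 * ?t (?t s) + 32 * ?t s + 8 * s)
      + 256 * fps_X * fps_X * (?t (?t (?t s)) + 3 * ?t (?t s) + 3 * ?t s + s)) (Suc (Suc n)) = 0"
    unfolding 0 by simp
  then show ?thesis
    by (simp add: s y_def numeral_fps_const mult.assoc algebra_simps power2_eq_square power3_eq_cube)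
qed

text \<open>After scaling by 16^n both sides obey the same three-term recurrence, since 2x(x+1) =
  -1/2 at x = -1/2. They agree at 0 and 1, and the leading coefficient (n+2)^3 is nonzero.\<close>

lemma Vseq_eq_Vpoly: "of_nat (Vseq n) = (16 ^ n * Vpoly n (- 1 / 2) :: rat)"
proof (induction n rule: induct_nat_012)
  case (ge2 n)
  define y :: rat where "y = of_nat (Suc n)"
  have y: "y + 1 \<noteq> 0" unfolding y_def by (metis add.commute of_nat_Suc of_nat_neq_0)
  have "(y + 1) ^ 3 * of_nat (Vseq (Suc (Suc n))) = (y + 1) ^ 3 * (16 ^ Suc (Suc n) * Vpoly (Suc (Suc n)) (- 1 / 2))"
  proof -
    define w :: rat where "w = 16 ^ n"
    have "(y + 1) ^ 3 * of_nat (Vseq (Suc (Suc n)))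
        = 8 * (2 * y + 1) * (2 * y ^ 2 + 2 * y + 1) * (16 * w * Vpoly (Suc n) (- 1 / 2)) - 256 * y ^ 3 * (w * Vpoly n (- 1 / 2))"
      using Vseq_recurrence[of n, folded y_def] ge2 by (simp add: w_def)
    also have "\<dots> = 256 * w * ((2 * y + 1) * (y ^ 2 + y + 1 + 2 * (- 1 / 2 * (- 1 / 2 + 1))) * Vpoly (Suc n) (- 1 / 2) - y ^ 3 * Vpoly n (- 1 / 2))"
      by (simp add: algebra_simps)
    also have "\<dots> = (y + 1) ^ 3 * (256 * w * Vpoly (Suc (Suc n)) (- 1 / 2))"
      unfolding Vpoly_recurrence[of n "- 1 / 2 :: rat", folded y_def, symmetric] by (simp only: mult_ac)
    finally show ?thesis by (simp add: w_def)
  qed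
  with y show ?case by simp
qed (simp_all add: Vseq_def Vpoly_def)

section \<open>Binomial coefficients modulo powers of \<open>p\<close>\<close>

context prime_modulus
begin

lemma p_integral_inverse_less: "0 < i \<Longrightarrow> i < p \<Longrightarrow> 1 / of_nat i \<in> p_integral p"
  by (rule p_integral_inverse_nat) (auto dest: dvd_imp_le)

lemma p_integral_H: "m < p \<Longrightarrow> H m \<in> p_integral p"
  unfolding H_def by (intro p_integral_intros p_integral_inverse_less) auto

text \<open>For k < p every division in the recursion is by a unit, so no power of p is
  lost.\<close>

lemma pcong_gbinomial:
  assumes "pcong p m x y"
  shows "k < p \<Longrightarrow> pcong p m (x gchoose k) (y gchoose k)"
proof (induction k)
  case 0
  then show ?case by (simp add: pcong_refl p_integral_intros)
next
  case (Suc k)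
  have e: "(z gchoose Suc k) = 1 / of_nat (Suc k) * ((z - of_nat k) * (z gchoose k))" for z :: rat
    unfolding gbinomial_Suc_mult[symmetric] by (simp del: of_nat_Suc)
  have "pcong p m ((x - of_nat k) * (x gchoose k)) ((y - of_nat k) * (y gchoose k))"
    using Suc assms by (intro pcong_mult pcong_diff pcong_refl p_integral_intros) auto
  then show ?case unfolding e
    by (intro pcong_cmult p_integral_inverse_less) (use Suc.prems in auto)
qed

lemma pcong_gchoose_pair:
  assumes "pcong p m x y" "k < p"
  shows "pcong p m (gchoose_pair k x) (gchoose_pair k y)"
  unfolding gchoose_pair_def
  using assms by (intro pcong_mult pcong_gbinomial pcong_diff pcong_refl p_integral_intros)

lemma p_integral_gchoose_pair:
  assumes "x \<in> p_integral p" "k < p"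
  shows "gchoose_pair k x \<in> p_integral p"
  using pcong_gchoose_pair[OF pcong_refl[OF assms(1), of 1] assms(2)] by (simp add: pcong_def)

text \<open>Expanding the product, every term that takes two or more of the summands with a factor p
  is divisible by p^2.\<close>

lemma pcong_prod_one_add:
  assumes "\<And>i. i \<in> A \<Longrightarrow> s i \<in> p_integral p"
  shows "pcong p 2 (\<Prod>i\<in>A. 1 + of_nat p * s i) (1 + of_nat p * (\<Sum>i\<in>A. s i))"
  using assms
proof (induction A rule: infinite_finite_induct)
  case (insert j A)
  define t where "t = (\<Sum>i\<in>A. s i)"
  have st: "s j \<in> p_integral p" "t \<in> p_integral p"
    using insert.prems unfolding t_def by (auto intro: p_integral_intros)
  have "pcong p 2 ((1 + of_nat p * s j) * (\<Prod>i\<in>A. 1 + of_nat p * s i)) ((1 + of_nat p * s j) * (1 + of_nat p * t))"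
    unfolding t_def using insert st
    by (intro pcong_cmult p_integral_intros) auto
  also have "pcong p 2 ((1 + of_nat p * s j) * (1 + of_nat p * t)) (1 + of_nat p * (s j + t))"
    by (rule pcongI[ where c = "s j * t"])
       (use st in \<open>auto intro!: p_integral_intros simp: algebra_simps power2_eq_square\<close>)
  finally show ?case using insert by (simp add: t_def p)
qed (auto intro!: pcong_refl p_integral_intros)

text \<open>Replacing i by p - i gives 1/(p-i) \<equiv> -1/i, hence H(p-1-r) \<equiv> H(r) - H(p-1).
  The case r = 0 gives 2 H(p-1) \<equiv> 0, and 2 is invertible.\<close>

lemma H_reflect:
  assumes "p > 2" "r < p"
  shows "pcong p 1 (H (p - 1 - r)) (H r)"
proof -
  have *: "pcong p 1 (H (p - 1 - r)) (H r - H (p - 1))" if "r < p" for r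
  proof -
    have "H (p - 1 - r) = (\<Sum>i=r+1..p-1. 1 / of_nat (p - i))"
      unfolding H_def
      by (rule sum.reindex_bij_witness[of _ "\<lambda>i. p - i" "\<lambda>i. p - i"]) (use that in auto)
    moreover have "pcong p 1 (\<Sum>i=r+1..p-1. 1 / of_nat (p - i)) (\<Sum>i=r+1..p-1. - (1 / of_nat i))"
    proof (rule pcong_sum)
      fix i assume i: "i \<in> {r+1..p-1}"
      then have Z: "1 / of_nat i \<in> p_integral p" "1 / of_nat (p - i) \<in> p_integral p"
        by (auto intro: p_integral_inverse_less)
      have "1 / v - - (1 / u) = (u + v) ^ 1 * (1 / u * (1 / v))" if "u \<noteq> 0" "v \<noteq> 0" for u v :: rat
        using that by (simp add: field_simps)
      moreover have "i + (p - i) = p" using i that by auto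
      then have "of_nat i + of_nat (p - i) = (of_nat p :: rat)" by (metis of_nat_add)
      moreover have "(of_nat i :: rat) \<noteq> 0" "of_nat (p - i) \<noteq> (0 :: rat)" using i that by auto
      ultimately have "1 / of_nat (p - i) - - (1 / of_nat i) = of_nat p ^ 1 * (1 / of_nat i * (1 / of_nat (p - i)) :: rat)"
        by metis
      with Z show "pcong p 1 (1 / of_nat (p - i)) (- (1 / of_nat i))"
        by (intro pcongI[where c = "1 / of_nat i * (1 / of_nat (p - i))"] p_integral_intros)
    qed
    moreover have "H (p - 1) = H r + (\<Sum>i=r+1..p-1. 1 / of_nat i)"
      unfolding H_def using that sum.ub_add_nat[of 1 r "\<lambda>i. 1 / of_nat i :: rat" "p - 1 - r"] by simp
    ultimately show ?thesis by (simp add: sum_negf)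
  qed
  have "pcong p 1 (1 / of_nat 2 * (H (p - 1) + H (p - 1))) (1 / of_nat 2 * ((- H (p - 1)) + H (p - 1)))"
    using *[of 0] assms p_integral_H[of "p - 1"]
    by (intro pcong_cmult pcong_add p_integral_inverse_less pcong_refl) (auto simp: H_def)
  then have "pcong p 1 (H (p - 1)) 0" by simp
  then have "pcong p 1 (H r - H (p - 1)) (H r - 0)"
    using assms by (intro pcong_diff pcong_refl p_integral_H) auto
  from pcong_trans[OF *[OF assms(2)] this] show ?thesis by simp
qed

text \<open>The numerator factor with i = r equals pt and cancels the p in p!. The other factors and
  (p-1)! are both written as the product of the r - i times factors 1 + O(p), giving the ratio X/Y
  to compute modulo p^2.\<close>

lemma gbinomial_prime:
  assumes "p > 2" "r < p" "t \<in> p_integral p"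
  shows "pcong p 2 ((of_nat r + of_nat p * t) gchoose p) (t * (1 + of_nat p * H r))"
proof -
  define A where "A = {..<p} - {r}"
  define K where "K = H (p - 1 - r)"
  define u :: "nat \<Rightarrow> rat" where "u i = of_nat r - of_nat i" for i
  \<comment> \<open>Adding p to the negative differences r - i makes \<open>u i + p * e i\<close>
    run through 1, ..., p-1, so the product over \<open>A\<close> is (p-1)!.\<close>
  define e :: "nat \<Rightarrow> rat" where "e i = (if i > r then 1 else 0)" for i
  define X where "X = (\<Prod>i\<in>A. 1 + of_nat p * (t * (1 / u i)))"
  define Y where "Y = (\<Prod>i\<in>A. 1 + of_nat p * (e i * (1 / u i)))"
  have p0: "(of_nat p :: rat) \<noteq> 0" using assms by simp
  have A: "finite A" "A = {..<r} \<union> {r<..<p}" using assms by (auto simp: A_def)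
  have u0: "u i \<noteq> 0" if "i \<in> A" for i using that by (auto simp: u_def A_def)
  have uZ: "1 / u i \<in> p_integral p" if "i \<in> A" for i
  proof (cases "i < r")
    case True
    then have "u i = of_nat (r - i)" by (simp add: u_def)
    then show ?thesis using True assms by (auto intro!: p_integral_inverse_less simp del: of_nat_diff)
  next
    case False
    then have "0 < i - r" "i - r < p" "of_nat (i - r) = (of_nat i - of_nat r :: rat)"
      using that by (auto simp: A_def)
    moreover from this have "1 / u i = - (1 / of_nat (i - r))"
      by (metis minus_diff_eq minus_divide_right u_def)
    ultimately show ?thesis by (metis p_integral_minus p_integral_inverse_less)
  qed
  have eZ: "e i \<in> p_integral p" for i by (auto simp: e_def intro: p_integral_intros)
  have HZ: "H r \<in> p_integral p" "K \<in> p_integral p" unfolding K_def using assms by (auto intro!: p_integral_H)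
  have H: "pcong p 1 K (H r)" unfolding K_def by (rule H_reflect) (use assms in auto)
  have s1: "(\<Sum>i<r. 1 / u i) = H r" unfolding H_def u_def
    by (rule sum.reindex_bij_witness[of _ "\<lambda>i. r - i" "\<lambda>i. r - i"]) auto
  have s2: "(\<Sum>i\<in>{r<..<p}. 1 / u i) = - K" unfolding H_def u_def K_def sum_negf[symmetric]
    by (rule sum.reindex_bij_witness[of _ "\<lambda>i. r + i" "\<lambda>i. i - r"])
       (auto simp: divide_simps)
  have s3: "(\<Sum>i\<in>A. 1 / u i) = H r - K"
    unfolding A(2) using s1 s2 by (subst sum.union_disjoint) auto
  have s4: "(\<Sum>i\<in>A. e i * (1 / u i)) = - K"
  proof -
    have "(\<Sum>i\<in>A. e i * (1 / u i)) = (\<Sum>i\<in>{r<..<p}. 1 / u i)"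
      unfolding A(2) by (intro sum.mono_neutral_cong_right) (auto simp: e_def)
    then show ?thesis using s2 by simp
  qed
  have pH: "pcong p 2 (of_nat p * K) (of_nat p * H r)"
    using pcong_power_mult[OF H, of 1] by (simp add: numeral_2_eq_2)
  \<comment> \<open>The reciprocals of the \<open>u i\<close> sum to H(r) - H(p-1-r), which is 0
    modulo p by reflection; hence X \<equiv> 1 modulo p^2.\<close>
  have "pcong p 2 X (1 + of_nat p * (\<Sum>i\<in>A. t * (1 / u i)))"
    unfolding X_def using assms uZ by (intro pcong_prod_one_add p_integral_intros) auto
  also have "1 + of_nat p * (\<Sum>i\<in>A. t * (1 / u i)) = 1 + t * (of_nat p * H r - of_nat p * K)"
    unfolding sum_distrib_left[symmetric] s3 by (simp add: algebra_simps)
  also have "pcong p 2 \<dots> (1 + t * (of_nat p * H r - of_nat p * H r))"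
    using assms HZ
    by (intro pcong_add[OF pcong_refl] pcong_cmult[OF _ pcong_diff[OF pcong_refl pH]] p_integral_intros)
  finally have X: "pcong p 2 X 1" by simp
  have "pcong p 2 Y (1 + of_nat p * (\<Sum>i\<in>A. e i * (1 / u i)))"
    unfolding Y_def using uZ eZ by (intro pcong_prod_one_add p_integral_intros) auto
  also have "1 + of_nat p * (\<Sum>i\<in>A. e i * (1 / u i)) = 1 - of_nat p * K"
    unfolding s4 by simp
  also have "pcong p 2 \<dots> (1 - of_nat p * H r)"
    using pH by (intro pcong_diff pcong_refl p_integral_intros)
  finally have Y: "pcong p 2 Y (1 - of_nat p * H r)" by simp
  have Y0: "\<not> pcong p 1 Y 0"
  proof
    assume "pcong p 1 Y 0"
    then have 0: "pcong p 1 (1 - of_nat p * H r) 0"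
      using pcong_trans[OF pcong_sym[OF pcong_mono[OF Y, of 1]]] by simp
    have "pcong p 1 (1 - of_nat p * H r) 1"
      by (rule pcongI[ where c = "- H r"]) (use HZ in \<open>auto intro: p_integral_intros\<close>)
    from pcong_trans[OF pcong_sym[OF this] 0] have "pcong p 1 (of_int 1) (of_int 0)" by simp
    then show False using prime_gt_1_nat[OF p] by (simp only: pcong_int_iff) auto
  qed
  then have Yn: "Y \<noteq> 0" using pcong_refl[OF p_integral_intros(3)] by metis
  have YZ: "1 / Y \<in> p_integral p" "Y \<in> p_integral p"
    using p_integral_divide[OF _ _ Y0, of 1] Y by (auto simp: pcong_def p_integral_intros)
  \<comment> \<open>Inverts Y modulo p^2 through (1 - pH)(1 + pH) = 1 - p^2 H^2.\<close>
  have "pcong p 2 (Y * (1 + of_nat p * H r)) ((1 - of_nat p * H r) * (1 + of_nat p * H r))"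
    using HZ Y by (intro pcong_mult pcong_refl p_integral_intros)
  also have "pcong p 2 \<dots> 1"
    by (rule pcongI[ where c = "- (H r * H r)"])
       (use HZ in \<open>auto intro!: p_integral_intros simp: algebra_simps power2_eq_square\<close>)
  finally have "pcong p 2 (Y * (1 + of_nat p * H r)) 1" by simp
  then have "pcong p 2 (1 / Y * (Y * (1 + of_nat p * H r))) (1 / Y * X)"
    by (rule pcong_cmult[OF YZ(1) pcong_trans[OF _ pcong_sym[OF X]]])
  then have XY: "pcong p 2 (1 / Y * X) (1 + of_nat p * H r)"
    using Yn pcong_sym by (simp add: mult.assoc[symmetric])
  define x where "x = of_nat r + of_nat p * t"
  have "fact (p - 1) = (\<Prod>i=1..p-1. of_nat i :: rat)" by (simp add: fact_prod)
  also have "\<dots> = (\<Prod>i\<in>A. u i + of_nat p * e i)"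
    unfolding A_def u_def e_def
    by (rule prod.reindex_bij_witness[of _ "\<lambda>i. if i < r then r - i else p + r - i"
          "\<lambda>j. if j \<le> r then r - j else p + r - j"])
       (use assms in \<open>auto split: if_splits\<close>)
  also have "\<dots> = (\<Prod>i\<in>A. u i * (1 + of_nat p * (e i * (1 / u i))))"
    using u0 by (intro prod.cong) (auto simp: field_simps)
  finally have f: "fact (p - 1) = (\<Prod>i\<in>A. u i) * Y" by (simp only: prod.distrib Y_def)
  have "(\<Prod>i<p. x - of_nat i) = (x - of_nat r) * (\<Prod>i\<in>A. x - of_nat i)"
    unfolding A_def using assms by (intro prod.remove) auto
  also have "(\<Prod>i\<in>A. x - of_nat i) = (\<Prod>i\<in>A. u i * (1 + of_nat p * (t * (1 / u i))))"
    using u0 by (intro prod.cong) (auto simp: field_simps x_def u_def)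
  also have "\<dots> = (\<Prod>i\<in>A. u i) * X" by (simp only: prod.distrib X_def)
  finally have g: "(\<Prod>i<p. x - of_nat i) = of_nat p * t * ((\<Prod>i\<in>A. u i) * X)" by (simp add: x_def)
  have "fact p = (of_nat p * fact (p - 1) :: rat)" using assms by (simp add: fact_reduce)
  then have fp: "fact p = of_nat p * ((\<Prod>i\<in>A. u i) * Y)" by (simp only: f)
  have "x gchoose p = of_nat p * t * ((\<Prod>i\<in>A. u i) * X) / (of_nat p * ((\<Prod>i\<in>A. u i) * Y))"
    unfolding gbinomial_prod_rev atLeast0LessThan g fp ..
  also have "\<dots> = t * (1 / Y * X)"
    using p0 u0 A(1) by (simp add: prod_zero_iff)
  finally show ?thesis unfolding x_def using XY assms(3) by (simp only: pcong_cmult p)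
qed

section \<open>The general congruence\<close>


text \<open>If x has residue r and quotient t, then -1 - x has residue p-1-r and quotient -1-t. Both
  binomials are instances of \<open>gbinomial_prime\<close>, and reflection identifies the two
  harmonic numbers.\<close>

lemma gchoose_pair_prime:
  assumes "p > 2" "r < p" "t \<in> p_integral p" "x = of_nat r + of_nat p * t"
  shows "pcong p 2 (gchoose_pair p x) (- (t * (t + 1)) * (1 + 2 * of_nat p * H r))"
proof -
  define K where "K = H (p - 1 - r)"
  have HZ: "H r \<in> p_integral p" "K \<in> p_integral p" unfolding K_def using assms by (auto intro!: p_integral_H)
  have "(of_nat (p - 1 - r) :: rat) = of_nat p - 1 - of_nat r"
    using assms(2) by (subst of_nat_diff; simp)+
  then have x': "-1 - x = of_nat (p - 1 - r) + of_nat p * (- 1 - t)"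
    unfolding assms(4) by (simp add: algebra_simps)
  have pK: "pcong p 2 (of_nat p * K) (of_nat p * H r)"
    using pcong_power_mult[OF H_reflect[OF assms(1,2)], of 1] by (simp add: K_def numeral_2_eq_2)
  have K: "pcong p 2 ((- 1 - t) * (1 + of_nat p * K)) ((- 1 - t) * (1 + of_nat p * H r))"
    by (rule pcong_cmult[OF _ pcong_add[OF pcong_refl[OF p_integral_1] pK]]) (intro p_integral_intros assms(3))
  have "pcong p 2 ((-1 - x) gchoose p) ((- 1 - t) * (1 + of_nat p * K))"
    unfolding x' K_def using assms by (intro gbinomial_prime p_integral_intros) auto
  from pcong_mult[OF gbinomial_prime[OF assms(1-3), folded assms(4)] pcong_trans[OF this K]]
  have "pcong p 2 (gchoose_pair p x) (t * (1 + of_nat p * H r) * ((- 1 - t) * (1 + of_nat p * H r)))"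
    unfolding gchoose_pair_def .
  also have "pcong p 2 \<dots> (- (t * (t + 1)) * (1 + 2 * of_nat p * H r))"
    by (rule pcongI[where c = "- (t * (t + 1)) * H r * H r"])
       (use HZ assms in \<open>auto intro!: p_integral_intros simp: algebra_simps power2_eq_square\<close>)
  finally show ?thesis .
qed

lemma pcong_prod_squares:
  "k < p \<Longrightarrow> pcong p 4 (\<Prod>i=1..k. 1 - of_nat p ^ 2 / of_nat i ^ 2) (1 - of_nat p ^ 2 * (\<Sum>i=1..k. 1 / of_nat i ^ 2))"
proof (induction k)
  case 0
  then show ?case by (simp add: pcong_refl p_integral_intros)
next
  case (Suc k)
  define h :: rat where "h = (\<Sum>i=1..k. 1 / of_nat i ^ 2)"
  define s :: rat where "s = (1 / of_nat (Suc k)) ^ 2"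
  have sZ: "s \<in> p_integral p" unfolding s_def using Suc.prems
    by (intro p_integral_intros p_integral_inverse_less) auto
  have hZ: "h \<in> p_integral p"
  proof -
    have "h = (\<Sum>i=1..k. (1 / of_nat i) ^ 2)" by (simp add: h_def power_one_over)
    then show ?thesis using Suc.prems by (auto intro!: p_integral_sum p_integral_power p_integral_inverse_less)
  qed
  have "pcong p 4 ((1 - of_nat p ^ 2 * s) * (\<Prod>i=1..k. 1 - of_nat p ^ 2 / of_nat i ^ 2)) ((1 - of_nat p ^ 2 * s) * (1 - of_nat p ^ 2 * h))"
    unfolding h_def using Suc sZ by (intro pcong_cmult p_integral_intros) auto
  also have "pcong p 4 \<dots> (1 - of_nat p ^ 2 * (h + s))"
    by (rule pcongI[where c = "h * s"])
       (use sZ hZ in \<open>auto intro!: p_integral_intros simp: algebra_simps simp flip: power_add\<close>)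
  also have "h + s = (\<Sum>i=1..Suc k. 1 / of_nat i ^ 2)"
    by (simp add: h_def s_def power_one_over del: of_nat_Suc)
  also have "(1 - of_nat p ^ 2 * s) * (\<Prod>i=1..k. 1 - of_nat p ^ 2 / of_nat i ^ 2) = (\<Prod>i=1..Suc k. 1 - of_nat p ^ 2 / of_nat i ^ 2 :: rat)"
    by (simp add: s_def power_one_over mult.commute del: of_nat_Suc)
  finally show ?case .
qed

text \<open>Stated for an explicit decomposition x = r + pt, so that it also applies directly where
  r and t are known in closed form.\<close>

lemma weighted_sum_congruence:
  assumes "p > 2" "r < p" "t \<in> p_integral p" "x = of_nat r + of_nat p * t"
    and "\<not> pcong p 1 x 0" "\<not> pcong p 1 x (-1)"
  shows "pcong p 5 (\<Sum>n = 0..p - 1. of_nat (2 * n + 1) * Vpoly n x)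
     (of_nat p ^ 3 * (t * (t + 1) / (x * (x + 1)))
       + 2 * of_nat p ^ 4 * ((t * (t + 1) + 1) / (x * (x + 1))) * H r)"
proof -
  define a where "a = x * (x + 1)"
  define b where "b = 1 / a"
  define P where "P = gchoose_pair p x"
  define N where "N = p - 1"
  define h :: "nat \<Rightarrow> rat" where "h k = (\<Sum>i=1..k. 1 / of_nat i ^ 2)" for k
  define D where "D k = gchoose_pair k x / of_nat (Suc k)" for k
  define W :: "nat \<Rightarrow> rat" where "W k = (\<Prod>i=1..k. 1 - of_nat p ^ 2 / of_nat i ^ 2)" for k
  have pN: "p = Suc N" using assms by (simp add: N_def)
  have Np: "N < p" using pN by simp
  have p0: "(of_nat p :: rat) \<noteq> 0" using assms by simp
  have xZ: "x \<in> p_integral p" unfolding assms(4) by (intro p_integral_intros assms)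
  then have aZ: "a \<in> p_integral p" unfolding a_def by (intro p_integral_intros)
  have x1: "\<not> pcong p 1 (x + 1) 0"
  proof
    assume "pcong p 1 (x + 1) 0"
    then have "pcong p 1 (x + 1 - 1) (0 - 1)" by (intro pcong_diff pcong_refl p_integral_intros)
    then show False using assms(6) by simp
  qed
  have au: "\<not> pcong p 1 a 0"
    unfolding a_def using assms(5) x1 xZ by (subst pcong_0_mult_iff) (auto intro: p_integral_intros)
  then have a0: "a \<noteq> 0" using pcong_refl[OF p_integral_0] by metis
  have bZ: "b \<in> p_integral p" unfolding b_def using au aZ by (intro p_integral_divide p_integral_intros)
  have HZ: "H r \<in> p_integral p" using assms by (intro p_integral_H)
  have P: "pcong p 2 P (- (t * (t + 1)) * (1 + 2 * of_nat p * H r))"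
    unfolding P_def by (rule gchoose_pair_prime[OF assms(1-4)])
  then have PZ: "P \<in> p_integral p" by (simp add: pcong_def)
  have hZ: "h k \<in> p_integral p" if "k < p" for k
  proof -
    have "h k = (\<Sum>i=1..k. (1 / of_nat i) ^ 2)" by (simp add: h_def power_one_over)
    then show ?thesis using that by (auto intro!: p_integral_sum p_integral_power p_integral_inverse_less)
  qed
  \<comment> \<open>The denominator k+1 equals p at k = p-1, so the last term needs its own
    argument: the recurrence gives p^2 P_p = c P_{p-1} with c \<equiv> -a a unit, whence D_{p-1} = p
    P_p/c.\<close>
  have DZ: "D k \<in> p_integral p" if "k < p" for k
  proof (cases "k = N")
    case False
    then have "Suc k < p" using that pN by auto
    then have "1 / of_nat (Suc k) \<in> p_integral p" "gchoose_pair k x \<in> p_integral p"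
      using that xZ by (auto intro!: p_integral_inverse_less p_integral_gchoose_pair simp del: of_nat_Suc)
    then have "gchoose_pair k x * (1 / of_nat (Suc k)) \<in> p_integral p" by (intro p_integral_intros)
    then show ?thesis by (simp add: D_def del: of_nat_Suc)
  next
    case True
    define c where "c = of_nat N * of_nat p - a"
    have c: "pcong p 1 c (- a)"
      by (rule pcongI[where c = "of_nat N"]) (use aZ in \<open>auto simp: c_def intro: p_integral_intros\<close>)
    have cu: "\<not> pcong p 1 c 0"
    proof
      assume "pcong p 1 c 0"
      then have "pcong p 1 (- a) 0" using pcong_trans[OF pcong_sym[OF c]] by blast
      then show False using au pcong_minus[of 1 "- a" 0] by simp
    qed
    then have c0: "c \<noteq> 0" using pcong_refl[OF p_integral_0] by metis
    have "of_nat p ^ 2 * P = c * gchoose_pair N x"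
      using gchoose_pair_Suc[of N x] unfolding pN[symmetric] P_def c_def a_def .
    then have "D k = of_nat p * P / c"
      using c0 p0 unfolding D_def True pN[symmetric] by (simp add: field_simps power2_eq_square)
    moreover have "c \<in> p_integral p" unfolding c_def by (intro p_integral_intros aZ)
    ultimately show ?thesis using cu PZ by (auto intro!: p_integral_divide p_integral_intros)
  qed
  have bI: "s = b * y" if "a * s = y" for s y
    using that[symmetric] a0 by (simp add: b_def)
  have "a * (\<Sum>k<p. D k) = - of_nat p * P"
    using sum_gchoose_pair[of x p] unfolding D_def P_def a_def .
  then have s1: "(\<Sum>k<p. D k) = b * (- of_nat p * P)" by (rule bI)
  define E where "E = (\<Sum>k=1..N. gchoose_pair k x / of_nat k)"
  have "a * (\<Sum>k<p. h k * D k) = E - h N * of_nat p * P"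
    using sum_H2_gchoose_pair[of x N] unfolding pN[symmetric] D_def P_def a_def E_def h_def .
  then have s2: "(\<Sum>k<p. h k * D k) = b * (E - h N * of_nat p * P)" by (rule bI)
  have xr: "pcong p 1 x (of_nat r)"
    by (rule pcongI[where c = t]) (auto simp: assms intro: p_integral_intros)
  have "pcong p 1 E (\<Sum>k=1..N. gchoose_pair k (of_nat r) / of_nat k)"
    unfolding E_def
  proof (rule pcong_sum)
    fix k assume k: "k \<in> {1..N}"
    have "pcong p 1 (1 / of_nat k * gchoose_pair k x) (1 / of_nat k * gchoose_pair k (of_nat r))"
      using k pN xr by (intro pcong_cmult pcong_gchoose_pair p_integral_inverse_less) auto
    then show "pcong p 1 (gchoose_pair k x / of_nat k) (gchoose_pair k (of_nat r) / of_nat k)" by simp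
  qed
  also have "\<dots> = - 2 * H r" using assms pN by (intro sum_gchoose_pair_of_nat) auto
  finally have E: "pcong p 1 E (- 2 * H r)" .
  have "pcong p 1 (h N * of_nat p * P) 0"
    by (rule pcongI[where c = "h N * P"]) (use hZ[of N] PZ Np in \<open>auto intro!: p_integral_intros\<close>)
  with E have "pcong p 1 (\<Sum>k<p. h k * D k) (b * (- 2 * H r - 0))"
    unfolding s2 by (intro pcong_cmult bZ pcong_diff)
  from pcong_power_mult[OF this, of 2]
  have 2: "pcong p 3 (of_nat p ^ 2 * (\<Sum>k<p. h k * D k)) (of_nat p ^ 2 * (b * (- 2 * H r)))"
    by simp
  from pcong_power_mult[OF P, of 1]
  have 1: "pcong p 3 (of_nat p * P) (of_nat p * (- (t * (t + 1)) * (1 + 2 * of_nat p * H r)))"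
    by (simp add: eval_nat_numeral)
  have "pcong p 4 (\<Sum>k<p. D k * W k) (\<Sum>k<p. D k * (1 - of_nat p ^ 2 * h k))"
    unfolding W_def h_def using DZ by (intro pcong_sum pcong_cmult pcong_prod_squares) auto
  \<comment> \<open>Precision p^3 is enough here, because the factor p^2 in front of the sum raises
    it to p^5.\<close>
  then have "pcong p 3 (\<Sum>k<p. D k * W k) (\<Sum>k<p. D k * (1 - of_nat p ^ 2 * h k))"
    by (rule pcong_mono) simp
  also have "\<dots> = - b * (of_nat p * P) - of_nat p ^ 2 * (\<Sum>k<p. h k * D k)"
    using s1 by (simp add: right_diff_distrib sum_subtractf sum_distrib_left mult_ac)
  also have "pcong p 3 \<dots> (- b * (of_nat p * (- (t * (t + 1)) * (1 + 2 * of_nat p * H r)))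
      - of_nat p ^ 2 * (b * (- 2 * H r)))"
    by (intro pcong_diff pcong_cmult p_integral_intros bZ 1 2)
  finally have "pcong p 5 (of_nat p ^ 2 * (\<Sum>k<p. D k * W k))
     (of_nat p ^ 2 * (- b * (of_nat p * (- (t * (t + 1)) * (1 + 2 * of_nat p * H r)))
      - of_nat p ^ 2 * (b * (- 2 * H r))))"
    using pcong_power_mult[of 3 _ _ 2] by simp
  \<comment> \<open>In the coefficient of p^4 the part t(t+1) comes from the expansion of P_p, and
    the 1 added to it from the sum weighted by \<open>h\<close>.\<close>
  moreover have "of_nat p ^ 2 * (- b * (of_nat p * (- (t * (t + 1)) * (1 + 2 * of_nat p * H r)))
      - of_nat p ^ 2 * (b * (- 2 * H r)))
      = of_nat p ^ 3 * (t * (t + 1) * b) + 2 * of_nat p ^ 4 * ((t * (t + 1) + 1) * b) * H r"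
    by (simp add: algebra_simps power2_eq_square power3_eq_cube power4_eq_xxxx)
  moreover have "(\<Sum>n = 0..p - 1. of_nat (2 * n + 1) * Vpoly n x) = of_nat p ^ 2 * (\<Sum>k<p. D k * W k)"
  proof -
    have "{0..p - 1} = {..<p}" using pN by auto
    then show ?thesis using weighted_sum_Vpoly[where N = p and x = x] unfolding D_def W_def by (simp only: mult.commute[of "_ / _"])
  qed
  ultimately show ?thesis by (simp add: a_def[symmetric] b_def)
qed

section \<open>Harmonic numbers and Fermat quotients\<close>


lemma pcong_cancel:
  assumes "pcong p (Suc m) (a + of_nat p * b) (a + of_nat p * c)" "c \<in> p_integral p"
  shows "pcong p m b c"
  using assms(1)
proof (rule pcongE)
  fix d assume d: "d \<in> p_integral p" "a + of_nat p * b = a + of_nat p * c + of_nat p ^ Suc m * d"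
  have "p \<noteq> 0" using prime_gt_1_nat[OF p] by simp
  moreover have "of_nat p * (b - c) = of_nat p * (of_nat p ^ m * d)"
    using d(2) by (simp add: right_diff_distrib mult.assoc)
  ultimately have "b - c = of_nat p ^ m * d" by simp
  then show ?thesis using d(1) assms(2) by (intro pcongI)
qed

text \<open>Multiply m i = r_i + p f_i over 0 < i < p. The r_i permute the i, so m^(p-1) = \<Prod>(1
  + p f_i/r_i) and the quotient is \<Sum> f_i/r_i modulo p. A double count then yields harmonic
  numbers.\<close>

lemma lerch:
  assumes "p > 2" "\<not> p dvd m" "m > 0"
  shows "pcong p 1 (of_nat m * fermat_quot p m) (- (\<Sum>j = 1..<m. H (j * p div m)))"
proof -
  define A where "A = {1..<p}"
  define f where "f i = m * i div p" for i
  define r where "r i = m * i mod p" for i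
  have p0: "p > 0" "(of_nat p :: rat) \<noteq> 0" using assms by auto
  have nd: "\<not> p dvd m * i" if "i \<in> A" for i
    using that assms p by (auto simp: A_def prime_dvd_mult_iff dest: dvd_imp_le)
  have rA: "r i \<in> A" if "i \<in> A" for i
    using nd[OF that] p0 by (auto simp: r_def A_def Suc_le_eq dvd_eq_mod_eq_0)
  have "inj_on r A"
  proof (rule inj_onI)
    fix i j assume ij: "i \<in> A" "j \<in> A" "r i = r j"
    then have "int p dvd int m * (int i - int j)"
      by (simp add: r_def right_diff_distrib flip: mod_eq_dvd_iff of_nat_mult of_nat_mod)
    then have "int p dvd int i - int j"
      using assms p by (metis int_dvd_int_iff prime_dvd_mult_iff prime_nat_int_transfer)
    then have "i mod p = j mod p"
      by (metis mod_eq_dvd_iff of_nat_eq_iff of_nat_mod)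
    then show "i = j" using ij by (simp add: A_def)
  qed
  then have bij: "bij_betw r A A"
    using rA by (intro bij_betw_imageI endo_inj_surj) (auto simp: A_def)
  have u0: "(of_nat (r i) :: rat) \<noteq> 0" "(of_nat i :: rat) \<noteq> 0" if "i \<in> A" for i
    using rA[OF that] that by (auto simp: A_def)
  have uZ: "1 / of_nat (r i) \<in> p_integral p" "1 / of_nat i \<in> p_integral p" if "i \<in> A" for i
    using rA[OF that] that by (auto simp: A_def intro!: p_integral_inverse_less)
  have mi: "of_nat m * of_nat i = (of_nat (r i) + of_nat p * of_nat (f i) :: rat)" for i
    unfolding r_def f_def by (metis mod_mult_div_eq of_nat_add of_nat_mult)
  define X :: rat where "X = (\<Prod>i\<in>A. of_nat i)"
  have X0: "X \<noteq> 0" unfolding X_def using u0 by (auto simp: A_def prod_zero_iff)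
  have "of_nat m ^ (p - 1) * X = (\<Prod>i\<in>A. of_nat m * of_nat i)"
    by (simp add: X_def prod.distrib A_def)
  also have "\<dots> = (\<Prod>i\<in>A. of_nat (r i) * (1 + of_nat p * (of_nat (f i) * (1 / of_nat (r i)))))"
    unfolding mi using u0 by (intro prod.cong) (auto simp: field_simps)
  also have "\<dots> = (\<Prod>i\<in>A. of_nat (r i)) * (\<Prod>i\<in>A. 1 + of_nat p * (of_nat (f i) * (1 / of_nat (r i))))"
    by (rule prod.distrib)
  also have "(\<Prod>i\<in>A. of_nat (r i)) = X"
    unfolding X_def by (rule prod.reindex_bij_betw[OF bij])
  finally have m: "of_nat m ^ (p - 1) = (\<Prod>i\<in>A. 1 + of_nat p * (of_nat (f i) * (1 / of_nat (r i))) :: rat)"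
    using X0 by simp
  define S where "S = (\<Sum>i\<in>A. of_nat (f i) * (1 / of_nat (r i)) :: rat)"
  have SZ: "S \<in> p_integral p" unfolding S_def using uZ by (intro p_integral_intros)
  have "pcong p 2 (of_nat m ^ (p - 1)) (1 + of_nat p * S)"
    unfolding m S_def using uZ by (intro pcong_prod_one_add p_integral_intros)
  moreover have "of_nat m ^ (p - 1) = 1 + of_nat p * fermat_quot p m"
    using p0 by (simp add: fermat_quot_def)
  ultimately have "pcong p (Suc 1) (1 + of_nat p * fermat_quot p m) (1 + of_nat p * S)"
    by (simp add: numeral_2_eq_2)
  then have "pcong p 1 (fermat_quot p m) S" by (rule pcong_cancel[OF _ SZ])
  then have "pcong p 1 (of_nat m * fermat_quot p m) (of_nat m * S)"
    by (intro pcong_cmult p_integral_intros)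
  \<comment> \<open>Since r_i \<equiv> m i modulo p, the factor m turns 1/r_i into 1/i.\<close>
  also have "pcong p 1 (of_nat m * S) (\<Sum>i\<in>A. of_nat (f i) / of_nat i)"
    unfolding S_def sum_distrib_left
  proof (rule pcong_sum)
    fix i assume i: "i \<in> A"
    have "M * (F * (1 / R)) - F / I = P ^ 1 * (F * F * (1 / I * (1 / R)))"
      if "M * I = R + P * F" "R \<noteq> 0" "I \<noteq> 0" for M F R I P :: rat
    proof -
      have "M * (F * (1 / R)) - F / I = F * (M * I - R) * (1 / I * (1 / R))"
        using that(2,3) by (simp add: field_simps)
      then show ?thesis unfolding that(1) by simp
    qed
    from this[OF mi u0[OF i]]
    have "of_nat m * (of_nat (f i) * (1 / of_nat (r i))) - of_nat (f i) / of_nat i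
      = of_nat p ^ 1 * (of_nat (f i) * of_nat (f i) * (1 / of_nat i * (1 / of_nat (r i))) :: rat)" .
    moreover have "of_nat (f i) * of_nat (f i) * (1 / of_nat i * (1 / of_nat (r i))) \<in> p_integral p"
      by (intro p_integral_intros uZ[OF i])
    moreover have "of_nat (f i) / of_nat i \<in> p_integral p"
      using p_integral_mult[OF p_integral_of_nat uZ(2)[OF i], of "f i"] by simp
    ultimately show "pcong p 1 (of_nat m * (of_nat (f i) * (1 / of_nat (r i)))) (of_nat (f i) / of_nat i)"
      by (intro pcongI)
  qed
  \<comment> \<open>The floor f_i counts the j in 1, ..., m-1 with j p \<le> m i, which prepares the
    interchange of sums.\<close>
  also have "(\<Sum>i\<in>A. of_nat (f i) / of_nat i) = (\<Sum>i\<in>A. \<Sum>j\<in>{j\<in>{1..<m}. j * p \<le> m * i}. 1 / of_nat i :: rat)"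
  proof (rule sum.cong[OF refl])
    fix i assume i: "i \<in> A"
    have *: "j * p \<le> m * i \<longleftrightarrow> j \<le> f i" for j
      unfolding f_def using p0 by (simp add: less_eq_div_iff_mult_less_eq)
    have "f i < m" unfolding f_def using i assms(3) by (simp add: A_def less_mult_imp_div_less)
    then have "{j\<in>{1..<m}. j * p \<le> m * i} = {1..f i}" unfolding * by auto
    then show "of_nat (f i) / of_nat i = (\<Sum>j\<in>{j\<in>{1..<m}. j * p \<le> m * i}. 1 / of_nat i :: rat)" by simp
  qed
  also have "\<dots> = (\<Sum>j\<in>{1..<m}. \<Sum>i\<in>{i\<in>A. j * p \<le> m * i}. 1 / of_nat i)"
    by (rule sum.swap_restrict) (auto simp: A_def)
  also have "\<dots> = (\<Sum>j\<in>{1..<m}. H (p - 1) - H (j * p div m))"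
  proof (rule sum.cong[OF refl])
    fix j assume j: "j \<in> {1..<m}"
    define l where "l = j * p div m"
    have lp: "l < p" using j p0 unfolding l_def by (simp add: less_mult_imp_div_less)
    \<comment> \<open>Equality cannot occur because p does not divide m i, so the weak inequality
      becomes the strict bound on i.\<close>
    have *: "j * p \<le> m * i \<longleftrightarrow> l < i" if i: "i \<in> A" for i
    proof -
      have "j * p \<noteq> m * i" using nd[OF i] by (metis dvd_triv_right)
      moreover have "l < i \<longleftrightarrow> j * p < i * m" unfolding l_def using assms(3) by (simp add: div_less_iff_less_mult)
      ultimately show ?thesis by (auto simp: mult.commute)
    qed
    have "{i\<in>A. j * p \<le> m * i} = {i\<in>A. l < i}" using * by blast
    also have "\<dots> = {l+1..p-1}" using lp by (auto simp: A_def)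
    finally have "{i\<in>A. j * p \<le> m * i} = {l+1..p-1}" .
    then show "(\<Sum>i\<in>{i\<in>A. j * p \<le> m * i}. 1 / of_nat i) = H (p - 1) - H (j * p div m)"
      unfolding H_def l_def[symmetric] using lp sum.ub_add_nat[of 1 l "\<lambda>i. 1 / of_nat i :: rat" "p - 1 - l"] by simp
  qed
  also have "pcong p 1 \<dots> (\<Sum>j\<in>{1..<m}. 0 - H (j * p div m))"
  proof (intro pcong_sum pcong_diff pcong_refl p_integral_H)
    show "pcong p 1 (H (p - 1)) 0" using H_reflect[of 0] assms by (simp add: H_def)
    show "j * p div m < p" if "j \<in> {1..<m}" for j
      using that p0 by (simp add: less_mult_imp_div_less)
  qed
  finally show ?thesis by (simp add: sum_negf)
qed

lemma not_dvd_less: "0 < m \<Longrightarrow> m < p \<Longrightarrow> \<not> p dvd m"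
  by (auto dest: dvd_imp_le)

lemma sum_H_fermat_quot:
  assumes "p > m" "m > 1"
  shows "pcong p 1 (\<Sum>j = 1..<m. H (j * p div m)) (- (of_nat m * fermat_quot p m))"
  using pcong_minus[OF pcong_sym[OF lerch[of m]]] not_dvd_less[of m] assms by simp

lemma p_integral_fermat_quot:
  assumes "p > 2" "\<not> p dvd m" "m > 0"
  shows "fermat_quot p m \<in> p_integral p"
proof -
  have "1 / of_nat m * (of_nat m * fermat_quot p m) \<in> p_integral p"
    by (rule p_integral_mult[OF p_integral_inverse_nat[OF assms(2)]]) (use lerch[OF assms] in \<open>simp add: pcong_def\<close>)
  then show ?thesis using assms(3) by simp
qed

text \<open>Compare (mn)^(p-1) with the product of 1 + p q_p(m) and 1 + p q_p(n).\<close>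

lemma fermat_quot_mult:
  "fermat_quot p (m * n) = fermat_quot p m + fermat_quot p n + of_nat p * (fermat_quot p m * fermat_quot p n)"
proof -
  have "(of_nat p :: rat) \<noteq> 0" using prime_gt_1_nat[OF p] by simp
  then show ?thesis by (simp add: fermat_quot_def power_mult_distrib field_simps)
qed

lemma pcong_fermat_quot_mult:
  assumes "p > 2" "\<not> p dvd m" "m > 0" "\<not> p dvd n" "n > 0"
  shows "pcong p 1 (fermat_quot p (m * n)) (fermat_quot p m + fermat_quot p n)"
  unfolding fermat_quot_mult using assms
  by (intro pcongI[where c = "fermat_quot p m * fermat_quot p n"] p_integral_intros p_integral_fermat_quot) auto

lemma pcong_half: "p > 2 \<Longrightarrow> pcong p m (2 * a) b \<Longrightarrow> pcong p m a (b / 2)"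
  using pcong_cmult[OF p_integral_inverse_less[of 2], of m "2 * a" b] by simp

text \<open>The remainder b of j p by m is nonzero, since m is prime to p. Then (m-j)p = m(p-1-a) +
  (m-b) with 0 < m-b < m, where a is the quotient.\<close>

lemma div_reflect:
  assumes "0 < j" "j < m" "m < p"
  shows "(m - j) * p div m = p - 1 - j * p div m"
proof -
  define a b d where "a = j * p div m" and "b = j * p mod m" and "d = m - b"
  have "\<not> p dvd m" using assms by (intro not_dvd_less) auto
  then have "coprime m p" using prime_imp_coprime[OF p] coprime_commute by blast
  then have "\<not> m dvd j * p" using assms by (auto simp: coprime_dvd_mult_left_iff dest: dvd_imp_le)
  then have b: "0 < b" "b < m" using assms by (auto simp: b_def mod_greater_zero_iff_not_dvd)
  have ab: "j * p = m * a + b" by (simp add: a_def b_def)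
  have "a < p" unfolding a_def using assms by (simp add: less_mult_imp_div_less mult.commute)
  then obtain c where c: "p = a + c + 1" using less_iff_Suc_add by auto
  have "(m - j) * p = m * p - j * p" by (simp add: diff_mult_distrib)
  also have "\<dots> = m * c + d" unfolding ab using b by (simp add: c d_def algebra_simps)
  finally have e: "(m - j) * p = m * c + d" .
  have "d < m" using b by (simp add: d_def)
  then have "(m - j) * p div m = c" unfolding e by simp
  moreover have "c = p - 1 - a" using c by linarith
  ultimately show ?thesis by (simp only: a_def)
qed

section \<open>Harmonic numbers at the floors of p/2, p/3, p/4 and p/6\<close>

lemma H_half:
  assumes "p > 3"
  shows "pcong p 1 (H (p div 2)) (- 2 * fermat_quot p 2)"
proof -
  have "{1..<2} = {1::nat}" by auto
  then show ?thesis
    using sum_H_fermat_quot[of 2] assms by simp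
qed

text \<open>In Lerch's sum the terms j and m-j are congruent by reflection, so each is half of their
  sum.\<close>

lemma H_double:
  assumes "p > 2" "k < p" "pcong p 1 (H k + H (p - 1 - k)) b"
  shows "pcong p 1 (H k) (b / 2)"
proof -
  have "pcong p 1 (H k + H k) (H k + H (p - 1 - k))"
    using assms by (intro pcong_add pcong_refl p_integral_H pcong_sym[OF H_reflect])
  from pcong_half[OF assms(1), of 1 "H k" b] pcong_trans[OF this assms(3)] show ?thesis
    by simp
qed

lemma H_third:
  assumes "p > 3"
  shows "pcong p 1 (H (p div 3)) (- 3 / 2 * fermat_quot p 3)"
proof -
  have "{1..<3} = {1::nat, 2}" by auto
  moreover have "2 * p div 3 = p - 1 - p div 3" using div_reflect[of 1 3] assms by simp
  ultimately have "pcong p 1 (H (p div 3) + H (p - 1 - p div 3)) (- (3 * fermat_quot p 3))"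
    using sum_H_fermat_quot[of 3] assms by (simp add: add.commute)
  from H_double[OF _ _ this] show ?thesis using assms by simp
qed

text \<open>The terms j = 1, 3 of Lerch's sum pair up and j = 2 is \<open>H_half\<close>. With
  q_p(4) \<equiv> 2 q_p(2) the pair is -8 q_p(2) + 2 q_p(2).\<close>

lemma H_quarter:
  assumes "p > 4"
  shows "pcong p 1 (H (p div 4)) (- 3 * fermat_quot p 2)"
proof -
  have "{1..<4} = {1::nat, 2, 3}" by auto
  moreover have "3 * p div 4 = p - 1 - p div 4" using div_reflect[of 1 4] assms by simp
  moreover have "2 * p div 4 = p div 2" by linarith
  ultimately have 1: "pcong p 1 (H (p div 4) + H (p - 1 - p div 4) + H (p div 2)) (- (4 * fermat_quot p 4))"
    using sum_H_fermat_quot[of 4] assms by (simp add: add_ac)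
  have "pcong p 1 (fermat_quot p (2 * 2)) (fermat_quot p 2 + fermat_quot p 2)"
    using assms not_dvd_less[of 2] by (intro pcong_fermat_quot_mult) auto
  then have "pcong p 1 (4 * fermat_quot p 4) (4 * (fermat_quot p 2 + fermat_quot p 2))"
    by (intro pcong_cmult p_integral_intros) simp
  from pcong_diff[OF pcong_trans[OF 1 pcong_minus[OF this]] H_half] assms
  have "pcong p 1 (H (p div 4) + H (p - 1 - p div 4)) (- 6 * fermat_quot p 2)"
    by simp
  from H_double[OF _ _ this] show ?thesis using assms by simp
qed

text \<open>The terms j = 1, 5 form the wanted pair; j = 2, 4 contribute -3 q_p(3) and j = 3
  contributes -2 q_p(2), to be subtracted from -6(q_p(2) + q_p(3)).\<close>

lemma H_sixth:
  assumes "p > 6"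
  shows "pcong p 1 (H (p div 6)) (- (4 * fermat_quot p 2 + 3 * fermat_quot p 3) / 2)"
proof -
  have "{1..<6} = {1::nat, 2, 3, 4, 5}" by auto
  moreover have "2 * p div 6 = p div 3" "3 * p div 6 = p div 2" by linarith+
  moreover from this have "4 * p div 6 = p - 1 - p div 3" "5 * p div 6 = p - 1 - p div 6"
    using div_reflect[of 2 6] div_reflect[of 1 6] assms by simp_all
  ultimately have 1: "pcong p 1 (H (p div 6) + H (p - 1 - p div 6) + (H (p div 3) + H (p - 1 - p div 3) + H (p div 2)))
      (- (6 * fermat_quot p 6))"
    using sum_H_fermat_quot[of 6] assms by (simp add: add_ac)
  have H3: "pcong p 1 (H (p div 3)) (- 3 / 2 * fermat_quot p 3)"
    using assms by (intro H_third) auto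
  have "pcong p 1 (H (p - 1 - p div 3)) (- 3 / 2 * fermat_quot p 3)"
    using assms by (intro pcong_trans[OF H_reflect H3]) auto
  note H = pcong_add[OF pcong_add[OF H3 this] H_half]
  have "pcong p 1 (fermat_quot p (2 * 3)) (fermat_quot p 2 + fermat_quot p 3)"
    using assms not_dvd_less[of 2] not_dvd_less[of 3] by (intro pcong_fermat_quot_mult) auto
  then have "pcong p 1 (6 * fermat_quot p 6) (6 * (fermat_quot p 2 + fermat_quot p 3))"
    by (intro pcong_cmult p_integral_intros) simp
  from pcong_diff[OF pcong_trans[OF 1 pcong_minus[OF this]] H] assms
  have "pcong p 1 (H (p div 6) + H (p - 1 - p div 6)) (- (4 * fermat_quot p 2 + 3 * fermat_quot p 3))"
    by (simp add: algebra_simps)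
  from H_double[OF _ _ this] show ?thesis using assms by simp
qed

text \<open>For p \<equiv> 1 or -1 modulo m the quotient t of x = -1/m satisfies t(t+1) = x(x+1)
  exactly. The p^3 coefficient is thus 1, and the p^4 coefficient involves 1 + 1/(x(x+1)) = 1 -
  m^2/(m-1).\<close>

lemma weighted_sum_unit_fraction:
  assumes "p > 2" "1 < m" "m < p" "p mod m = 1 \<or> p mod m = m - 1" "pcong p 1 (H (p div m)) h"
  shows "pcong p 5 (\<Sum>n = 0..p - 1. of_nat (2 * n + 1) * Vpoly n (- 1 / of_nat m))
     (of_nat p ^ 3 + 2 * of_nat p ^ 4 * ((1 - of_nat m ^ 2 / (of_nat m - 1)) * h))"
proof -
  define x :: rat where "x = - 1 / of_nat m"
  define M :: rat where "M = of_nat m"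
  define L where "L = p div m"
  have M: "M \<noteq> 0" "M - 1 \<noteq> 0" "of_nat (m - 1) = M - 1" using assms(2) by (auto simp: M_def)
  have Z: "1 / M \<in> p_integral p" "1 / (M - 1) \<in> p_integral p" "M \<in> p_integral p"
    using assms p_integral_inverse_less[of "m - 1"] p_integral_inverse_less[of m] M
    by (auto simp: M_def p_integral_of_nat)
  have xM: "x = - (1 / M)" by (simp add: x_def M_def)
  have xZ: "x \<in> p_integral p" unfolding xM by (intro p_integral_intros Z)
  have Lp: "L < p" using assms unfolding L_def by (intro div_less_dividend) auto
  obtain r t where rt: "r < p" "t \<in> p_integral p" "x = of_nat r + of_nat p * t"
      "t * (t + 1) = - ((M - 1) / M ^ 2)" "pcong p 1 (H r) (H L)"
    using assms(4)
  proof
    assume "p mod m = 1"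
    then have "m * L + 1 = p" unfolding L_def by (metis mult_div_mod_eq)
    then have "(of_nat p :: rat) = M * of_nat L + 1" by (metis M_def of_nat_1 of_nat_add of_nat_mult)
    then show ?thesis using M Z Lp
      \<comment> \<open>From p = mL + 1 one gets -1/m = L + p(-1/m).\<close>
      by (intro that[of L "- (1 / M)"])
         (auto simp: xM field_simps power2_eq_square intro!: pcong_refl p_integral_H p_integral_minus)
  next
    assume "p mod m = m - 1"
    then have "m * L + (m - 1) = p" unfolding L_def by (metis mult_div_mod_eq)
    then have P: "(of_nat p :: rat) = M * of_nat L + (M - 1)" by (metis M(3) M_def of_nat_add of_nat_mult)
    have R: "(of_nat (p - 1 - L) :: rat) = of_nat p - 1 - of_nat L"
      using Lp by (subst of_nat_diff; simp)+
    have "pcong p 1 (H (p - 1 - L)) (H L)" using assms Lp by (intro H_reflect)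
    moreover have "1 / M - 1 \<in> p_integral p" by (intro p_integral_intros Z)
    ultimately show ?thesis using M Lp
      \<comment> \<open>From p = mL + m - 1 one gets -1/m = (p-1-L) + p(1/m - 1); reflection brings
        the harmonic number back to index L.\<close>
      by (intro that[of "p - 1 - L" "1 / M - 1"])
         (auto simp: xM R P field_simps power2_eq_square)
  qed
  have a: "x * (x + 1) = - ((M - 1) / M ^ 2)" using M by (simp add: xM field_simps power2_eq_square)
  have 0: "\<not> pcong p 1 x 0"
  proof
    assume "pcong p 1 x 0"
    from pcong_cmult[OF p_integral_minus[OF Z(3)] this] have "pcong p 1 (of_int 1) (of_int 0)"
      using M by (simp add: xM)
    then show False using assms(1) by (simp only: pcong_int_iff) auto
  qed
  have 1: "\<not> pcong p 1 x (-1)"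
  proof
    assume "pcong p 1 x (-1)"
    \<comment> \<open>Multiplying by m gives -1 \<equiv> -m, so p would divide m - 1, although 0 < m
      - 1 < p.\<close>
    from pcong_cmult[OF Z(3) this] have "pcong p 1 (of_int (- 1)) (of_int (- int m))"
      using M by (simp add: xM M_def)
    then have "int p dvd int (m - 1)" using assms(2) by (simp only: pcong_int_iff) (simp add: of_nat_diff)
    then have "p dvd m - 1" by (simp only: int_dvd_int_iff)
    moreover have "0 < m - 1" "m - 1 < p" using assms by linarith+
    ultimately show False using not_dvd_less by blast
  qed
  define c where "c = 1 - M ^ 2 / (M - 1)"
  have cZ: "c \<in> p_integral p"
  proof -
    have "1 - M * M * (1 / (M - 1)) \<in> p_integral p" by (intro p_integral_intros Z)
    then show ?thesis by (simp add: c_def power2_eq_square)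
  qed
  have "(t * (t + 1) + 1) / (x * (x + 1)) = c" "t * (t + 1) / (x * (x + 1)) = 1"
    unfolding rt(4) a c_def using M by (auto simp: field_simps)
  with weighted_sum_congruence[OF assms(1) rt(1-3) 0 1]
  have "pcong p 5 (\<Sum>n = 0..p - 1. of_nat (2 * n + 1) * Vpoly n x) (of_nat p ^ 3 + 2 * of_nat p ^ 4 * c * H r)"
    by simp
  also have "pcong p 5 (of_nat p ^ 3 + 2 * of_nat p ^ 4 * c * H r) (of_nat p ^ 3 + 2 * of_nat p ^ 4 * (c * h))"
  proof -
    have "pcong p 1 (2 * c * H r) (2 * c * h)"
      by (intro pcong_cmult p_integral_intros cZ pcong_trans[OF rt(5)]) (use assms(5) in \<open>simp add: L_def\<close>)
    from pcong_power_mult[OF this, of 4]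
    have "pcong p 5 (2 * of_nat p ^ 4 * c * H r) (2 * of_nat p ^ 4 * (c * h))"
      by (simp add: mult_ac)
    then show ?thesis by (intro pcong_add pcong_refl p_integral_intros)
  qed
  finally show ?thesis unfolding x_def c_def M_def .
qed

end

theorem theorem4p5:
  fixes p :: nat
  assumes "prime p" and "p > 3"
  shows "(\<forall>x \<in> p_integral p. \<not> pcong p 1 x 0 \<longrightarrow> \<not> pcong p 1 x (-1) \<longrightarrow>
           (let x' = pquot p x in
            pcong p 5 (\<Sum>n = 0..p - 1. of_nat (2 * n + 1) * Vpoly n x)
              (of_nat p ^ 3 * (x' * (x' + 1) / (x * (x + 1)))
               + 2 * of_nat p ^ 4 * ((x' * (x' + 1) + 1) / (x * (x + 1))) * H (presidue p x))))
       \<and> pcong p 5 (\<Sum>n = 0..p - 1. of_nat (2 * n + 1) * (of_nat (Vseq n) / 16 ^ n))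
           (of_nat p ^ 3 + 12 * of_nat p ^ 4 * fermat_quot p 2)
       \<and> pcong p 5 (\<Sum>n = 0..p - 1. of_nat (2 * n + 1) * (V3 n / 27 ^ n))
           (of_nat p ^ 3 + 21 / 2 * of_nat p ^ 4 * fermat_quot p 3)
       \<and> pcong p 5 (\<Sum>n = 0..p - 1. of_nat (2 * n + 1) * (V4 n / 64 ^ n))
           (of_nat p ^ 3 + 26 * of_nat p ^ 4 * fermat_quot p 2)
       \<and> (p > 5 \<longrightarrow>
           pcong p 5 (\<Sum>n = 0..p - 1. of_nat (2 * n + 1) * (V6 n / 432 ^ n))
             (of_nat p ^ 3 + 31 / 5 * of_nat p ^ 4 * (4 * fermat_quot p 2 + 3 * fermat_quot p 3)))"
proof -
  interpret prime_modulus p by unfold_locales (rule assms(1))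
  \<comment> \<open>Being prime to 6 forces p \<equiv> 1 or -1 modulo each of 2, 3, 4 and 6, as the
    specialisations require.\<close>
  have "odd p" "\<not> 3 dvd p" using assms prime_odd_nat[of p] prime_nat_iff[of p] by auto
  then have mods: "p mod 2 = 1" "p mod 3 = 1 \<or> p mod 3 = 2" "p mod 4 = 1 \<or> p mod 4 = 3" "p mod 6 = 1 \<or> p mod 6 = 5"
    by presburger+
  then have p4: "p > 4" using assms(2) by (cases "p = 4") auto
  note u = weighted_sum_unit_fraction
  show ?thesis
  proof (intro conjI ballI impI)
    fix x assume "x \<in> p_integral p" "\<not> pcong p 1 x 0" "\<not> pcong p 1 x (-1)"
    then show "let x' = pquot p x in
            pcong p 5 (\<Sum>n = 0..p - 1. of_nat (2 * n + 1) * Vpoly n x)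
              (of_nat p ^ 3 * (x' * (x' + 1) / (x * (x + 1)))
               + 2 * of_nat p ^ 4 * ((x' * (x' + 1) + 1) / (x * (x + 1))) * H (presidue p x))"
      unfolding Let_def using assms(2) by (intro weighted_sum_congruence presidue pquot) auto
  next
    show "pcong p 5 (\<Sum>n = 0..p - 1. of_nat (2 * n + 1) * (of_nat (Vseq n) / 16 ^ n))
           (of_nat p ^ 3 + 12 * of_nat p ^ 4 * fermat_quot p 2)"
      \<comment> \<open>For m = 2, 3, 4, 6 the factor 1 - m^2/(m-1) is -3, -7/2, -13/3, -31/5. Twice
        its product with the value of the harmonic number gives the constants 12, 21/2, 26 and
        31/5.\<close>
      using u[of 2, OF _ _ _ _ H_half] mods assms(2) by (simp add: Vseq_eq_Vpoly mult.assoc)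
  next
    show "pcong p 5 (\<Sum>n = 0..p - 1. of_nat (2 * n + 1) * (V3 n / 27 ^ n))
           (of_nat p ^ 3 + 21 / 2 * of_nat p ^ 4 * fermat_quot p 3)"
      using u[of 3, OF _ _ _ _ H_third] mods assms(2) by (simp add: V3_def mult_ac)
  next
    show "pcong p 5 (\<Sum>n = 0..p - 1. of_nat (2 * n + 1) * (V4 n / 64 ^ n))
           (of_nat p ^ 3 + 26 * of_nat p ^ 4 * fermat_quot p 2)"
      using u[of 4, OF _ _ _ _ H_quarter] mods p4 by (simp add: V4_def mult.assoc)
  next
    assume "p > 5"
    moreover have "p \<noteq> 6" using mods by auto
    ultimately have "p > 6" by simp
    then show "pcong p 5 (\<Sum>n = 0..p - 1. of_nat (2 * n + 1) * (V6 n / 432 ^ n))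
             (of_nat p ^ 3 + 31 / 5 * of_nat p ^ 4 * (4 * fermat_quot p 2 + 3 * fermat_quot p 3))"
      using u[of 6, OF _ _ _ _ H_sixth] mods by (simp add: V6_def algebra_simps diff_divide_distrib add_divide_distrib)
  qed
qed

end
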